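(* Let $R$ be a non-associative ring with pairwise commuting additive bijections $\sigma_1,\ldots,\sigma_n\colon R\to R$ such that $\sigma_i(1)=1$ for all $i\in\{1,\ldots,n\}$. Then the iterated generalized Laurent polynomial ring $R[X_1^\pm,\ldots,X_n^\pm;\sigma_1,\ldots,\sigma_n]$ is simple if and only if $R$ is $(\sigma_1,\ldots,\sigma_n)$-simple and there do not exist $u\in N_m(R)\cap N_r(R)\cap R^\times$ and a non-zero $(m_1,\ldots,m_n)\in\mathbb{Z}^n$ such that for all $r\in R$ and $i\in\{1,\ldots,n\}$ the following equalities hold: (i) $(\sigma_1^{m_1}\circ\cdots\circ\sigma_n^{m_n})(r)=u^{-1}ru$; (ii) $\sigma_i(ru)=\sigma_i(r)u$.
   Context: A non-associative ring is a unital ring that is not necessarily associative. "Ideal" means two-sided ideal, and a non-associative ring is simple if it is non-zero and its only ideals are $\{0\}$ and itself. The associator is $(r,s,t)=(rs)t-r(st)$. The middle nucleus is $N_m(R)=\{s\in R: (r,s,t)=0 \text{ for all } r,t\in R\}$ and the right nucleus is $N_r(R)=\{t\in R:(r,s,t)=0\text{ for all } r,s\in R\}$. $R^\times$ is the set of elements $u\in R$ for which there exist $v,w\in R$ with $vu=1$ and $uw=1$; if $u\in N_m(R)\cap R^\times$, then the left inverse $v$ and right inverse $w$ are unique and equal, and $u^{-1}$ denotes this element. For $u\in N_r(R)$ one has $(u^{-1}r)u=u^{-1}(ru)$, so $u^{-1}ru$ is unambiguous. For an additive bijection $\sigma$ on a non-associative ring $R$ with $\sigma(1)=1$, $R[X^{\pm};\sigma]$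 is the additive group of formal sums $\sum_{i\in\mathbb{Z}}r_iX^i$ ($r_i\in R$, all but finitely many zero) with pointwise addition and multiplication given by the biadditive extension of $(rX^m)(sX^k)=(r\sigma^m(s))X^{m+k}$; it is a non-associative ring. Given pairwise commuting additive bijections $\sigma_1,\dots,\sigma_n$ on $R$ fixing $1$, set $S_1=R[X_1^\pm;\sigma_1]$ and, for $1\le i<n$, $S_{i+1}=S_i[X_{i+1}^\pm;\widehat{\sigma}_{i+1}]$, where $\widehat{\sigma}_{i+1}$ is the additive bijection of $S_i$ defined by $\widehat{\sigma}_{i+1}(rX_1^{m_1}\cdots X_i^{m_i})=\sigma_{i+1}(r)X_1^{m_1}\cdots X_i^{m_i}$. The ring $S_n$ is denoted $R[X_1^\pm,\ldots,X_n^\pm;\sigma_1,\ldots,\sigma_n]$. An ideal $I$ of $R$ is a $(\sigma_1,\ldots,\sigma_n)$-ideal if $\sigma_i(I)=I$ for all $i\in\{1,\ldots,n\}$; $R$ is $(\sigma_1,\ldots,\sigma_n)$-simple if $\{0\}$ and $R$ are the only $(\sigma_1,\ldots,\sigma_n)$-ideals of $R$. *)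

theory Defs
  imports "HOL-Algebra.Weak_Morphisms"
begin

section \<open>Non-associative rings\<close>

locale nonassoc_ring = abelian_group R for R (structure) +
  assumes m_closed [intro, simp]:
      "\<lbrakk>x \<in> carrier R; y \<in> carrier R\<rbrakk> \<Longrightarrow> x \<otimes> y \<in> carrier R"
    and one_closed [intro, simp]: "\<one> \<in> carrier R"
    and l_one [simp]: "x \<in> carrier R \<Longrightarrow> \<one> \<otimes> x = x"
    and r_one [simp]: "x \<in> carrier R \<Longrightarrow> x \<otimes> \<one> = x"
    and l_distr: "\<lbrakk>x \<in> carrier R; y \<in> carrier R; z \<in> carrier R\<rbrakk>
      \<Longrightarrow> (x \<oplus> y) \<otimes> z = x \<otimes> z \<oplus> y \<otimes> z"
    and r_distr: "\<lbrakk>x \<in> carrier R; y \<in> carrier R; z \<in> carrier R\<rbrakk>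
      \<Longrightarrow> z \<otimes> (x \<oplus> y) = z \<otimes> x \<oplus> z \<otimes> y"

(* The library locale ideal cannot be used here: it includes associativity of the ring. *)
locale nonassoc_ideal = additive_subgroup I R for I and R (structure) +
  assumes l_closed: "\<lbrakk>a \<in> I; r \<in> carrier R\<rbrakk> \<Longrightarrow> r \<otimes> a \<in> I"
    and r_closed: "\<lbrakk>a \<in> I; r \<in> carrier R\<rbrakk> \<Longrightarrow> a \<otimes> r \<in> I"

definition nonassoc_simple :: "('a, 'm) ring_scheme \<Rightarrow> bool" where
  "nonassoc_simple R \<longleftrightarrow> carrier R \<noteq> {\<zero>\<^bsub>R\<^esub>} \<and>
     (\<forall>I. nonassoc_ideal I R \<longrightarrow> I = {\<zero>\<^bsub>R\<^esub>} \<or> I = carrier R)"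

definition associator :: "('a, 'm) ring_scheme \<Rightarrow> 'a \<Rightarrow> 'a \<Rightarrow> 'a \<Rightarrow> 'a" where
  "associator R r s t = ((r \<otimes>\<^bsub>R\<^esub> s) \<otimes>\<^bsub>R\<^esub> t) \<ominus>\<^bsub>R\<^esub> (r \<otimes>\<^bsub>R\<^esub> (s \<otimes>\<^bsub>R\<^esub> t))"

definition middle_nucleus :: "('a, 'm) ring_scheme \<Rightarrow> 'a set" where
  "middle_nucleus R =
     {s \<in> carrier R. \<forall>r\<in>carrier R. \<forall>t\<in>carrier R. associator R r s t = \<zero>\<^bsub>R\<^esub>}"

definition right_nucleus :: "('a, 'm) ring_scheme \<Rightarrow> 'a set" where
  "right_nucleus R =
     {t \<in> carrier R. \<forall>r\<in>carrier R. \<forall>s\<in>carrier R. associator R r s t = \<zero>\<^bsub>R\<^esub>}"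

(* Left and right inverse may differ, in contrast to the library's Units. *)
definition nonassoc_units :: "('a, 'm) ring_scheme \<Rightarrow> 'a set" where
  "nonassoc_units R =
     {u \<in> carrier R. \<exists>v\<in>carrier R. \<exists>w\<in>carrier R. v \<otimes>\<^bsub>R\<^esub> u = \<one>\<^bsub>R\<^esub> \<and> u \<otimes>\<^bsub>R\<^esub> w = \<one>\<^bsub>R\<^esub>}"

context nonassoc_ring
begin

lemma associator_zeroD:
  assumes "associator R r s t = \<zero>" "r \<in> carrier R" "s \<in> carrier R" "t \<in> carrier R"
  shows "(r \<otimes> s) \<otimes> t = r \<otimes> (s \<otimes> t)"
proof -
  have "(r \<otimes> s) \<otimes> t \<oplus> \<ominus> (r \<otimes> (s \<otimes> t)) = \<zero>"
    using assms by (simp add: associator_def a_minus_def)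
  then show ?thesis
    using assms minus_equality[of "(r \<otimes> s) \<otimes> t" "\<ominus> (r \<otimes> (s \<otimes> t))"] by simp
qed

(* The library's inv denotes the element that is both the left and the right inverse. *)
lemma inv_middle_nucleus:
  assumes u: "u \<in> middle_nucleus R" "u \<in> nonassoc_units R"
  shows "inv u \<in> carrier R" "inv u \<otimes> u = \<one>" "u \<otimes> inv u = \<one>"
    and "\<And>v. \<lbrakk>v \<in> carrier R; v \<otimes> u = \<one>\<rbrakk> \<Longrightarrow> v = inv u"
    and "\<And>w. \<lbrakk>w \<in> carrier R; u \<otimes> w = \<one>\<rbrakk> \<Longrightarrow> w = inv u"
proof -
  have uc: "u \<in> carrier R"
    using u(2) by (simp add: nonassoc_units_def)
  have eq: "v = w"
    if "v \<in> carrier R" "w \<in> carrier R" "v \<otimes> u = \<one>" "u \<otimes> w = \<one>" for v w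
  proof -
    have "(v \<otimes> u) \<otimes> w = v \<otimes> (u \<otimes> w)"
      using u(1) that uc by (intro associator_zeroD) (auto simp: middle_nucleus_def)
    then show ?thesis using that by simp
  qed
  obtain v w where "v \<in> carrier R" "w \<in> carrier R" "v \<otimes> u = \<one>" "u \<otimes> w = \<one>"
    using u(2) by (auto simp: nonassoc_units_def)
  then have v: "v \<in> carrier R" "v \<otimes> u = \<one>" "u \<otimes> v = \<one>"
    using eq by auto
  have "inv u = v"
    unfolding m_inv_def using v eq by (intro the_equality) auto
  then show "inv u \<in> carrier R" "inv u \<otimes> u = \<one>" "u \<otimes> inv u = \<one>"
    "\<And>v. \<lbrakk>v \<in> carrier R; v \<otimes> u = \<one>\<rbrakk> \<Longrightarrow> v = inv u"
    "\<And>w. \<lbrakk>w \<in> carrier R; u \<otimes> w = \<one>\<rbrakk> \<Longrightarrow> w = inv u"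
    using v eq by auto
qed

end

section \<open>Additive bijections and invariant ideals\<close>

definition additive_bijection :: "('a, 'm) ring_scheme \<Rightarrow> ('a \<Rightarrow> 'a) \<Rightarrow> bool" where
  "additive_bijection R \<sigma> \<longleftrightarrow> bij_betw \<sigma> (carrier R) (carrier R) \<and>
     (\<forall>r\<in>carrier R. \<forall>s\<in>carrier R. \<sigma> (r \<oplus>\<^bsub>R\<^esub> s) = \<sigma> r \<oplus>\<^bsub>R\<^esub> \<sigma> s)"

definition int_funpow :: "'a set \<Rightarrow> ('a \<Rightarrow> 'a) \<Rightarrow> int \<Rightarrow> 'a \<Rightarrow> 'a" where
  "int_funpow A \<sigma> k = (if 0 \<le> k then \<sigma> ^^ nat k else inv_into A \<sigma> ^^ nat (- k))"

text \<open>The composition \<open>\<sigma> 1 ^ m 1 \<circ> \<dots> \<circ> \<sigma> n ^ m n\<close>.\<close>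

primrec multi_funpow :: "'a set \<Rightarrow> (nat \<Rightarrow> 'a \<Rightarrow> 'a) \<Rightarrow> (nat \<Rightarrow> int) \<Rightarrow> nat \<Rightarrow> 'a \<Rightarrow> 'a" where
  "multi_funpow A \<sigma> m 0 = id"
| "multi_funpow A \<sigma> m (Suc n) = multi_funpow A \<sigma> m n \<circ> int_funpow A (\<sigma> (Suc n)) (m (Suc n))"

definition sigma_ideal :: "nat \<Rightarrow> (nat \<Rightarrow> 'a \<Rightarrow> 'a) \<Rightarrow> 'a set \<Rightarrow> ('a, 'm) ring_scheme \<Rightarrow> bool" where
  "sigma_ideal n \<sigma> I R \<longleftrightarrow> nonassoc_ideal I R \<and> (\<forall>i\<in>{1..n}. \<sigma> i ` I = I)"

definition sigma_simple :: "nat \<Rightarrow> (nat \<Rightarrow> 'a \<Rightarrow> 'a) \<Rightarrow> ('a, 'm) ring_scheme \<Rightarrow> bool" where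
  "sigma_simple n \<sigma> R \<longleftrightarrow>
     (\<forall>I. sigma_ideal n \<sigma> I R \<longrightarrow> I = {\<zero>\<^bsub>R\<^esub>} \<or> I = carrier R)"

section \<open>Generalized Laurent polynomial rings\<close>

text \<open>
  A formal sum is represented by its coefficient function \<open>f\<close>. The coefficient of the product
  at \<open>k\<close> collects all \<open>(f i X^i) (g (k - i) X^(k - i)) = f i \<sigma>^i(g (k - i)) X^k\<close>.
\<close>

definition laurent_ring :: "('a, 'm) ring_scheme \<Rightarrow> ('a \<Rightarrow> 'a) \<Rightarrow> (int \<Rightarrow> 'a) ring" where
  "laurent_ring R \<sigma> =
    \<lparr> carrier = {f. (\<forall>i. f i \<in> carrier R) \<and> finite {i. f i \<noteq> \<zero>\<^bsub>R\<^esub>}},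
      mult = (\<lambda>f g k. finsum R (\<lambda>i. f i \<otimes>\<^bsub>R\<^esub> int_funpow (carrier R) \<sigma> i (g (k - i)))
                              {i. f i \<noteq> \<zero>\<^bsub>R\<^esub>}),
      one = (\<lambda>i. if i = 0 then \<one>\<^bsub>R\<^esub> else \<zero>\<^bsub>R\<^esub>),
      zero = (\<lambda>_. \<zero>\<^bsub>R\<^esub>),
      add = (\<lambda>f g i. f i \<oplus>\<^bsub>R\<^esub> g i) \<rparr>"

definition laurent_monom :: "('a, 'm) ring_scheme \<Rightarrow> 'a \<Rightarrow> int \<Rightarrow> int \<Rightarrow> 'a" where
  "laurent_monom R r m = (\<lambda>i. if i = m then r else \<zero>\<^bsub>R\<^esub>)"

lemma (in nonassoc_ring) l_null: "x \<in> carrier R \<Longrightarrow> \<zero> \<otimes> x = \<zero>"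
  using l_distr[of \<zero> \<zero> x] add.r_cancel_one'[of "\<zero> \<otimes> x" "\<zero> \<otimes> x"] by simp

lemma (in nonassoc_ring) r_null: "x \<in> carrier R \<Longrightarrow> x \<otimes> \<zero> = \<zero>"
  using r_distr[of \<zero> \<zero> x] add.r_cancel_one'[of "x \<otimes> \<zero>" "x \<otimes> \<zero>"] by simp

lemma (in nonassoc_ring) int_funpow_additive:
  assumes "additive_bijection R \<sigma>"
  shows "additive_bijection R (int_funpow (carrier R) \<sigma> k)"
proof -
  have pow: "additive_bijection R (\<tau> ^^ n)" if "additive_bijection R \<tau>" for \<tau> n
  proof (induction n)
    case 0
    then show ?case by (simp add: additive_bijection_def bij_betw_def)
  next
    case (Suc n)
    then have "bij_betw (\<tau> \<circ> \<tau> ^^ n) (carrier R) (carrier R)"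
      using that unfolding additive_bijection_def by (blast intro: bij_betw_trans)
    moreover have "(\<tau> ^^ n) r \<in> carrier R" if "r \<in> carrier R" for r
      using Suc that unfolding additive_bijection_def by (blast dest: bij_betwE)
    ultimately show ?case
      using Suc that by (simp add: additive_bijection_def comp_def)
  qed
  let ?i = "inv_into (carrier R) \<sigma>"
  have b: "bij_betw \<sigma> (carrier R) (carrier R)"
    using assms by (simp add: additive_bijection_def)
  then have b': "bij_betw ?i (carrier R) (carrier R)"
    by (rule bij_betw_inv_into)
  have "?i (r \<oplus> s) = ?i r \<oplus> ?i s" if rs: "r \<in> carrier R" "s \<in> carrier R" for r s
  proof -
    have ic: "?i r \<in> carrier R" "?i s \<in> carrier R"
      using b' rs by (auto simp: bij_betwE)
    have "\<sigma> (?i r \<oplus> ?i s) = r \<oplus> s"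
      using assms ic rs b by (simp add: additive_bijection_def bij_betw_inv_into_right)
    then show ?thesis
      using ic b by (metis add.m_closed bij_betw_inv_into_left)
  qed
  then have "additive_bijection R ?i"
    using b' by (simp add: additive_bijection_def)
  then show ?thesis
    using pow assms by (simp add: int_funpow_def)
qed

lemma (in nonassoc_ring) laurent_monom_mult:
  assumes \<sigma>: "additive_bijection R \<sigma>" and r: "r \<in> carrier R" and s: "s \<in> carrier R"
  shows "laurent_monom R r m \<otimes>\<^bsub>laurent_ring R \<sigma>\<^esub> laurent_monom R s k =
         laurent_monom R (r \<otimes> int_funpow (carrier R) \<sigma> m s) (m + k)"
proof -
  let ?p = "int_funpow (carrier R) \<sigma> m"
  have p: "additive_bijection R ?p"
    using \<sigma> by (rule int_funpow_additive)
  then have pc: "?p x \<in> carrier R" if "x \<in> carrier R" for x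
    using that by (auto simp: additive_bijection_def bij_betwE)
  have "?p (\<zero> \<oplus> \<zero>) = ?p \<zero> \<oplus> ?p \<zero>"
    using p unfolding additive_bijection_def by blast
  then have p0: "?p \<zero> = \<zero>"
    using pc[of \<zero>] add.r_cancel_one'[of "?p \<zero>" "?p \<zero>"] by simp
  have supp: "{i. laurent_monom R r m i \<noteq> \<zero>} = (if r = \<zero> then {} else {m})"
    by (auto simp: laurent_monom_def)
  have sc: "laurent_monom R s k j \<in> carrier R" for j
    using s by (simp add: laurent_monom_def)
  show ?thesis
  proof (cases "r = \<zero>")
    case True
    then have "{i. laurent_monom R r m i \<noteq> \<zero>} = {}"
      using supp by simp
    then show ?thesis
      using True pc[OF s] by (simp add: laurent_ring_def laurent_monom_def l_null)
  next
    case False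
    then have *: "{i. laurent_monom R r m i \<noteq> \<zero>} = {m}"
      using supp by simp
    have "(\<Oplus>i\<in>{m}. laurent_monom R r m i \<otimes> int_funpow (carrier R) \<sigma> i (laurent_monom R s k (j - i)))
        = r \<otimes> ?p (laurent_monom R s k (j - m))" for j
    proof -
      have "laurent_monom R r m m = r"
        by (simp add: laurent_monom_def)
      moreover have "r \<otimes> ?p (laurent_monom R s k (j - m)) \<in> carrier R"
        using r pc[OF sc] by simp
      ultimately show ?thesis
        by (simp add: finsum_insert)
    qed
    moreover have "r \<otimes> ?p (laurent_monom R s k (j - m)) = laurent_monom R (r \<otimes> ?p s) (m + k) j" for j
      using r p0 by (cases "j = m + k") (auto simp: laurent_monom_def r_null)
    ultimately show ?thesis
      unfolding laurent_ring_def by (simp add: * fun_eq_iff)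
  qed
qed

text \<open>
  All iterated rings have to live in one type. \<open>Laurent f\<close> is the formal sum over \<open>i\<close> of
  \<open>f i X^i\<close> whose coefficients belong to the previous ring. The coefficientwise
  extension of a map on \<open>R\<close> is then \<open>map_tower\<close>.
\<close>

datatype 'a tower = Base 'a | Laurent "int \<Rightarrow> 'a tower"

text \<open>
  \<open>iterated_laurent R \<sigma> n\<close> is \<open>R[X_1\<^sup>\<plusminus>, \<dots>, X_n\<^sup>\<plusminus>; \<sigma> 1, \<dots>, \<sigma> n]\<close>; only \<open>\<sigma> 1, \<dots>, \<sigma> n\<close> are used.
  The library constant \<open>image_ring\<close> transports a ring structure along an injective map.
\<close>

primrec iterated_laurent ::
    "('a, 'm) ring_scheme \<Rightarrow> (nat \<Rightarrow> 'a \<Rightarrow> 'a) \<Rightarrow> nat \<Rightarrow> 'a tower ring" where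
  "iterated_laurent R \<sigma> 0 = image_ring Base R"
| "iterated_laurent R \<sigma> (Suc i) =
     image_ring Laurent (laurent_ring (iterated_laurent R \<sigma> i) (map_tower (\<sigma> (Suc i))))"

end

theory Submission
  imports Defs "HOL-Library.Function_Algebras"
begin

text \<open>
  The iterated ring \<open>S\<close> is graded by \<open>\<int>\<^sup>n\<close>, with monomials multiplying as
  \<open>(r X\<^sup>a) (s X\<^sup>b) = r \<sigma>\<^sup>a(s) X\<^sup>a\<^sup>+\<^sup>b\<close>.

  If \<open>S\<close> is simple, an invariant ideal \<open>J\<close> of \<open>R\<close> is trivial because the elements with all coefficients
  in \<open>J\<close> form an ideal. A pair \<open>(u, m)\<close> would make \<open>w = u X\<^sup>m\<close> commute with everything and lie in the
  middle and right nuclei, so that all \<open>x - x w\<close> would form a non-zero ideal; it does not contain \<open>1\<close>,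
  since solving \<open>1 = s - s w\<close> along the multiples of \<open>m\<close> gives infinitely many non-zero coefficients.

  Conversely, take a non-zero ideal \<open>I\<close> and a minimal support \<open>A\<close> of its non-zero elements, translated so
  that \<open>0 \<in> A\<close>. For \<open>c \<in> A\<close> the coefficients at \<open>c\<close> of elements of \<open>I\<close> supported in \<open>A\<close> form a non-zero
  invariant ideal, hence all of \<open>R\<close>. So there is such a \<open>g\<close> with coefficient \<open>1\<close> at \<open>0\<close>. The elements
  \<open>r g - g r\<close>, \<open>(r s) g - r (s g)\<close>, \<open>(r g) s - r (g s)\<close> and \<open>X\<^sub>i (r g) X\<^sub>i\<^sup>-\<^sup>1 - \<sigma>\<^sub>i(r) g\<close> vanish at \<open>0\<close>,
  so they are zero by minimality, and any further non-zero coefficient \<open>u\<close> of \<open>g\<close>, say at \<open>m\<close>, gives a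
  forbidden pair. Therefore \<open>g = 1\<close> and \<open>I = S\<close>.
\<close>

section \<open>Non-associative rings and their ideals\<close>

lemma (in abelian_group) additive_subgroup_criterion:
  assumes "H \<subseteq> carrier G" "\<zero> \<in> H"
    and "\<And>x y. \<lbrakk>x \<in> H; y \<in> H\<rbrakk> \<Longrightarrow> x \<oplus> y \<in> H"
    and "\<And>x. x \<in> H \<Longrightarrow> \<ominus> x \<in> H"
  shows "additive_subgroup H G"
proof (rule additive_subgroupI, rule add.subgroupI)
  show "H \<noteq> {}" using assms(2) by blast
qed (use assms in auto)

lemma (in abelian_group) additive_subgroup_add_closed:
  "\<lbrakk>additive_subgroup H G; x \<in> H; y \<in> H\<rbrakk> \<Longrightarrow> x \<oplus> y \<in> H"
  by (rule additive_subgroup.a_closed)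

lemma (in abelian_group) additive_subgroup_minus_closed:
  assumes "additive_subgroup H G" "x \<in> H" "y \<in> H"
  shows "x \<ominus> y \<in> H"
proof -
  interpret H: additive_subgroup H G by fact
  have "\<ominus> y \<in> H"
    using H.a_subgroup subgroup.m_inv_closed[of H "add_monoid G" y] assms(3)
    by (simp add: a_inv_def)
  then show ?thesis
    using assms(2) by (simp add: a_minus_def)
qed

context nonassoc_ring
begin

lemma r_neg_mult: "\<lbrakk>x \<in> carrier R; y \<in> carrier R\<rbrakk> \<Longrightarrow> x \<otimes> (\<ominus> y) = \<ominus> (x \<otimes> y)"
  using r_distr[of "\<ominus> y" y x] minus_equality[of "x \<otimes> (\<ominus> y)" "x \<otimes> y"]
  by (simp add: l_neg r_null)

lemma l_neg_mult: "\<lbrakk>x \<in> carrier R; y \<in> carrier R\<rbrakk> \<Longrightarrow> (\<ominus> x) \<otimes> y = \<ominus> (x \<otimes> y)"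
  using l_distr[of "\<ominus> x" x y] minus_equality[of "(\<ominus> x) \<otimes> y" "x \<otimes> y"]
  by (simp add: l_neg l_null)

lemma r_distr_minus:
  "\<lbrakk>x \<in> carrier R; y \<in> carrier R; z \<in> carrier R\<rbrakk> \<Longrightarrow> z \<otimes> (x \<ominus> y) = z \<otimes> x \<ominus> z \<otimes> y"
  by (simp add: a_minus_def r_distr r_neg_mult)

lemma l_distr_minus:
  "\<lbrakk>x \<in> carrier R; y \<in> carrier R; z \<in> carrier R\<rbrakk> \<Longrightarrow> (x \<ominus> y) \<otimes> z = x \<otimes> z \<ominus> y \<otimes> z"
  by (simp add: a_minus_def l_distr l_neg_mult)

lemma minus_self: "x \<in> carrier R \<Longrightarrow> x \<ominus> x = \<zero>"
  by (simp add: a_minus_def r_neg)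

lemma minus_eq_zeroD: "\<lbrakk>x \<ominus> y = \<zero>; x \<in> carrier R; y \<in> carrier R\<rbrakk> \<Longrightarrow> x = y"
  using minus_equality[of x "\<ominus> y"] by (simp add: a_minus_def)

lemma associator_eq_zero:
  assumes "(r \<otimes> s) \<otimes> t = r \<otimes> (s \<otimes> t)" "r \<in> carrier R" "s \<in> carrier R" "t \<in> carrier R"
  shows "associator R r s t = \<zero>"
  using assms by (simp add: associator_def minus_self)

lemma nonassoc_idealI:
  assumes "additive_subgroup I R"
    and "\<And>a r. \<lbrakk>a \<in> I; r \<in> carrier R\<rbrakk> \<Longrightarrow> r \<otimes> a \<in> I"
    and "\<And>a r. \<lbrakk>a \<in> I; r \<in> carrier R\<rbrakk> \<Longrightarrow> a \<otimes> r \<in> I"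
  shows "nonassoc_ideal I R"
  using assms by (simp add: nonassoc_ideal_def nonassoc_ideal_axioms_def)

lemma nonassoc_ideal_eq_carrier:
  assumes I: "nonassoc_ideal I R" and one: "\<one> \<in> I"
  shows "I = carrier R"
proof
  interpret I: nonassoc_ideal I R by fact
  show "I \<subseteq> carrier R" by (rule I.a_subset)
  show "carrier R \<subseteq> I" using I.l_closed[OF one] by fastforce
qed

lemma carrier_trivial:
  assumes "\<one> = \<zero>" shows "carrier R = {\<zero>}"
proof -
  have "x = \<zero>" if "x \<in> carrier R" for x
    using r_one[OF that] r_null[OF that] assms by simp
  then show ?thesis by blast
qed

lemma additive_bijection_zero:
  assumes "additive_bijection R \<tau>" shows "\<tau> \<zero> = \<zero>"
proof -
  have "\<tau> \<zero> \<in> carrier R"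
    using assms by (auto simp: additive_bijection_def bij_betwE)
  moreover have "\<tau> (\<zero> \<oplus> \<zero>) = \<tau> \<zero> \<oplus> \<tau> \<zero>"
    using assms unfolding additive_bijection_def by blast
  ultimately show ?thesis
    using add.r_cancel_one'[of "\<tau> \<zero>" "\<tau> \<zero>"] by simp
qed

end

section \<open>Simplicity of a ring graded by a torsion-free abelian group\<close>

text \<open>The ring \<open>S\<close> is described only by coefficients and by products with a
  monomial on one side; this suffices because monomials span \<open>S\<close> additively. Degrees
  form a set \<open>\<Gamma>\<close> instead of a whole type, so that one type of degrees serves
  every number of variables.\<close>

locale skew_laurent = R?: nonassoc_ring R + S: nonassoc_ring S
  for R (structure) and S (structure) +
  fixes \<Gamma> :: "'g :: ab_group_add set" and act :: "'g \<Rightarrow> 'a \<Rightarrow> 'a"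
    and coeff :: "'b \<Rightarrow> 'g \<Rightarrow> 'a" and mon :: "'a \<Rightarrow> 'g \<Rightarrow> 'b"
  assumes grade_zero: "0 \<in> \<Gamma>"
    and grade_add: "\<lbrakk>a \<in> \<Gamma>; b \<in> \<Gamma>\<rbrakk> \<Longrightarrow> a + b \<in> \<Gamma>"
    and grade_minus: "a \<in> \<Gamma> \<Longrightarrow> - a \<in> \<Gamma>"
    and act_bijection: "a \<in> \<Gamma> \<Longrightarrow> additive_bijection R (act a)"
    and act_add: "\<lbrakk>a \<in> \<Gamma>; b \<in> \<Gamma>; r \<in> carrier R\<rbrakk> \<Longrightarrow> act (a + b) r = act a (act b r)"
    and act_one: "a \<in> \<Gamma> \<Longrightarrow> act a \<one> = \<one>"
    and coeff_closed: "f \<in> carrier S \<Longrightarrow> coeff f a \<in> carrier R"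
    and coeff_outside: "\<lbrakk>f \<in> carrier S; a \<notin> \<Gamma>\<rbrakk> \<Longrightarrow> coeff f a = \<zero>"
    and finite_support: "f \<in> carrier S \<Longrightarrow> finite {a. coeff f a \<noteq> \<zero>}"
    and coeff_inject: "\<lbrakk>f \<in> carrier S; g \<in> carrier S; \<And>a. a \<in> \<Gamma> \<Longrightarrow> coeff f a = coeff g a\<rbrakk> \<Longrightarrow> f = g"
    and coeff_add: "\<lbrakk>f \<in> carrier S; g \<in> carrier S\<rbrakk> \<Longrightarrow> coeff (f \<oplus>\<^bsub>S\<^esub> g) a = coeff f a \<oplus> coeff g a"
    and mon_closed: "\<lbrakk>r \<in> carrier R; a \<in> \<Gamma>\<rbrakk> \<Longrightarrow> mon r a \<in> carrier S"
    and coeff_mon: "\<lbrakk>r \<in> carrier R; a \<in> \<Gamma>\<rbrakk> \<Longrightarrow> coeff (mon r a) b = (if b = a then r else \<zero>)"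
    and coeff_mon_mult: "\<lbrakk>r \<in> carrier R; a \<in> \<Gamma>; f \<in> carrier S; b \<in> \<Gamma>\<rbrakk> \<Longrightarrow>
      coeff (mon r a \<otimes>\<^bsub>S\<^esub> f) b = r \<otimes> act a (coeff f (b - a))"
    and coeff_mult_mon: "\<lbrakk>r \<in> carrier R; a \<in> \<Gamma>; f \<in> carrier S; b \<in> \<Gamma>\<rbrakk> \<Longrightarrow>
      coeff (f \<otimes>\<^bsub>S\<^esub> mon r a) b = coeff f (b - a) \<otimes> act (b - a) r"
begin

lemma grade_diff: "\<lbrakk>a \<in> \<Gamma>; b \<in> \<Gamma>\<rbrakk> \<Longrightarrow> a - b \<in> \<Gamma>"
  using grade_add[of a "- b"] grade_minus[of b] by simp

lemma act_closed: "\<lbrakk>a \<in> \<Gamma>; r \<in> carrier R\<rbrakk> \<Longrightarrow> act a r \<in> carrier R"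
  using act_bijection[of a] by (auto simp: additive_bijection_def bij_betwE)

lemma act_zero: "a \<in> \<Gamma> \<Longrightarrow> act a \<zero> = \<zero>"
  by (rule additive_bijection_zero) (rule act_bijection)

lemma act_inject:
  assumes "a \<in> \<Gamma>" "r \<in> carrier R" "s \<in> carrier R" "act a r = act a s"
  shows "r = s"
proof -
  have "inj_on (act a) (carrier R)"
    using act_bijection[OF assms(1)] by (simp add: additive_bijection_def bij_betw_def)
  then show ?thesis using assms by (auto dest: inj_onD)
qed

text \<open>By \<open>act_add\<close> the map \<open>act 0\<close> is idempotent, and an injective
  idempotent map is the identity.\<close>

lemma act_0:
  assumes "r \<in> carrier R" shows "act 0 r = r"
proof (rule act_inject[OF grade_zero])
  show "act 0 (act 0 r) = act 0 r"
    using act_add[OF grade_zero grade_zero assms] by simp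
qed (simp_all add: assms grade_zero act_closed)

lemma act_minus: "\<lbrakk>a \<in> \<Gamma>; r \<in> carrier R\<rbrakk> \<Longrightarrow> act a (act (- a) r) = r"
  using act_add[of a "- a" r] by (simp add: grade_minus act_0)

lemma coeff_zero: "coeff \<zero>\<^bsub>S\<^esub> a = \<zero>"
  using coeff_add[of "\<zero>\<^bsub>S\<^esub>" "\<zero>\<^bsub>S\<^esub>" a] coeff_closed[of "\<zero>\<^bsub>S\<^esub>" a]
    R.add.r_cancel_one'[of "coeff \<zero>\<^bsub>S\<^esub> a" "coeff \<zero>\<^bsub>S\<^esub> a"] by simp

lemma coeff_neg:
  assumes "f \<in> carrier S" shows "coeff (\<ominus>\<^bsub>S\<^esub> f) a = \<ominus> coeff f a"
proof -
  have "coeff (\<ominus>\<^bsub>S\<^esub> f) a \<oplus> coeff f a = \<zero>"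
    using coeff_add[of "\<ominus>\<^bsub>S\<^esub> f" f a] assms by (simp add: S.l_neg coeff_zero)
  then show ?thesis
    using R.minus_equality assms by (simp add: coeff_closed)
qed

lemma coeff_minus:
  "\<lbrakk>f \<in> carrier S; g \<in> carrier S\<rbrakk> \<Longrightarrow> coeff (f \<ominus>\<^bsub>S\<^esub> g) a = coeff f a \<ominus> coeff g a"
  by (simp add: a_minus_def coeff_add coeff_neg)

lemma eq_zeroI:
  assumes "f \<in> carrier S" "\<And>a. a \<in> \<Gamma> \<Longrightarrow> coeff f a = \<zero>" shows "f = \<zero>\<^bsub>S\<^esub>"
  by (rule coeff_inject) (simp_all add: assms coeff_zero)

text \<open>Comparing coefficients shows that \<open>mon \<one> 0\<close> times the identity of
  \<open>S\<close> is that identity; the same product is \<open>mon \<one> 0\<close> itself.\<close>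

lemma one_eq_mon: "\<one>\<^bsub>S\<^esub> = mon \<one> 0"
proof -
  have "mon \<one> 0 \<otimes>\<^bsub>S\<^esub> \<one>\<^bsub>S\<^esub> = \<one>\<^bsub>S\<^esub>"
  proof (rule coeff_inject)
    show "coeff (mon \<one> 0 \<otimes>\<^bsub>S\<^esub> \<one>\<^bsub>S\<^esub>) a = coeff \<one>\<^bsub>S\<^esub> a" if "a \<in> \<Gamma>" for a
      using that by (subst coeff_mon_mult) (simp_all add: grade_zero act_0 coeff_closed)
  qed (simp_all add: mon_closed grade_zero)
  then show ?thesis by (simp add: mon_closed grade_zero)
qed

text \<open>Induction on the size of the support: subtracting the monomial at one of its degrees
  removes exactly that degree. This reduces additive statements about \<open>S\<close> to
  monomials.\<close>

lemma monomials_generate: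
  assumes H: "additive_subgroup H S"
    and mon: "\<And>r a. \<lbrakk>r \<in> carrier R; a \<in> \<Gamma>\<rbrakk> \<Longrightarrow> mon r a \<in> H"
    and f: "f \<in> carrier S"
  shows "f \<in> H"
  using f
proof (induction "card {a. coeff f a \<noteq> \<zero>}" arbitrary: f rule: less_induct)
  case less
  show ?case
  proof (cases "\<exists>a. coeff f a \<noteq> \<zero>")
    case False
    then have "f = \<zero>\<^bsub>S\<^esub>" using less.prems by (intro eq_zeroI) auto
    then show ?thesis using H additive_subgroup.zero_closed by blast
  next
    case True
    then obtain a where a: "coeff f a \<noteq> \<zero>" by blast
    then have aG: "a \<in> \<Gamma>" using less.prems coeff_outside by blast
    define p where "p = mon (coeff f a) a"
    have p: "p \<in> carrier S" "p \<in> H"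
      using less.prems aG by (auto simp: p_def coeff_closed mon_closed mon)
    have "coeff (f \<ominus>\<^bsub>S\<^esub> p) b = (if b = a then \<zero> else coeff f b)" for b
      using less.prems aG p
      by (simp add: coeff_minus p_def coeff_mon coeff_closed R.minus_self)
        (simp add: a_minus_def coeff_closed)
    then have "{b. coeff (f \<ominus>\<^bsub>S\<^esub> p) b \<noteq> \<zero>} = {b. coeff f b \<noteq> \<zero>} - {a}" by auto
    then have "card {b. coeff (f \<ominus>\<^bsub>S\<^esub> p) b \<noteq> \<zero>} < card {b. coeff f b \<noteq> \<zero>}"
      using a finite_support[OF less.prems] by (simp add: card_Diff1_less del: card_Diff_insert)
    then have "f \<ominus>\<^bsub>S\<^esub> p \<in> H" using less p by blast
    moreover have "f = (f \<ominus>\<^bsub>S\<^esub> p) \<oplus>\<^bsub>S\<^esub> p"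
      using less.prems p by (simp add: a_minus_def S.a_assoc S.l_neg)
    ultimately show ?thesis using H p(2) additive_subgroup.a_closed by metis
  qed
qed

section \<open>Extension of invariant ideals\<close>

definition extended_ideal :: "'a set \<Rightarrow> 'b set" where
  "extended_ideal J = {f \<in> carrier S. \<forall>a. coeff f a \<in> J}"

text \<open>A monomial on the left applies some \<open>act a\<close> to the coefficients and
  multiplies them, which stays in \<open>J\<close> by invariance; a monomial on the right only
  multiplies them. The factors that keep a fixed \<open>f\<close> inside form an additive subgroup,
  so monomials suffice.\<close>

lemma nonassoc_ideal_extended:
  assumes J: "nonassoc_ideal J R" and inv: "\<And>a. a \<in> \<Gamma> \<Longrightarrow> act a ` J = J"
  shows "nonassoc_ideal (extended_ideal J) S"
proof -
  interpret J: nonassoc_ideal J R by fact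
  have act_J: "act a j \<in> J" if "a \<in> \<Gamma>" "j \<in> J" for a j
    using inv[OF that(1)] that(2) by blast
  have Jneg: "\<ominus> x \<in> J" if "x \<in> J" for x
    using that R.additive_subgroup_minus_closed[OF J.is_additive_subgroup J.zero_closed that] J.a_Hcarr
    by (simp add: a_minus_def)
  have E: "additive_subgroup (extended_ideal J) S"
    by (rule S.additive_subgroup_criterion)
      (auto simp: extended_ideal_def coeff_zero coeff_add coeff_neg Jneg)
  have coeffI: "f \<in> extended_ideal J" if "f \<in> carrier S" "\<And>a. a \<in> \<Gamma> \<Longrightarrow> coeff f a \<in> J" for f
  proof -
    have "coeff f a \<in> J" for a
      using that coeff_outside[OF that(1), of a] by (cases "a \<in> \<Gamma>") auto
    then show ?thesis using that by (simp add: extended_ideal_def)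
  qed
  have closed: "f \<in> carrier S" "coeff f a \<in> J" if "f \<in> extended_ideal J" for f a
    using that by (auto simp: extended_ideal_def)
  note add = S.additive_subgroup_add_closed[OF E]
  note neg = S.additive_subgroup_minus_closed[OF E additive_subgroup.zero_closed[OF E]]
  show ?thesis
  proof (rule S.nonassoc_idealI[OF E])
    fix f g assume f: "f \<in> extended_ideal J" and g: "g \<in> carrier S"
    have "g \<in> {x \<in> carrier S. x \<otimes>\<^bsub>S\<^esub> f \<in> extended_ideal J}"
    proof (rule monomials_generate[OF _ _ g])
      show "additive_subgroup {x \<in> carrier S. x \<otimes>\<^bsub>S\<^esub> f \<in> extended_ideal J} S"
      proof (rule S.additive_subgroup_criterion; clarsimp simp: closed[OF f])
        show "\<zero>\<^bsub>S\<^esub> \<otimes>\<^bsub>S\<^esub> f \<in> extended_ideal J"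
          using closed[OF f] additive_subgroup.zero_closed[OF E] by (simp add: S.l_null)
      next
        fix x y assume "x \<in> carrier S" "y \<in> carrier S" "x \<otimes>\<^bsub>S\<^esub> f \<in> extended_ideal J" "y \<otimes>\<^bsub>S\<^esub> f \<in> extended_ideal J"
        then show "(x \<oplus>\<^bsub>S\<^esub> y) \<otimes>\<^bsub>S\<^esub> f \<in> extended_ideal J"
          using closed[OF f] by (simp add: S.l_distr add)
      next
        fix x assume "x \<in> carrier S" "x \<otimes>\<^bsub>S\<^esub> f \<in> extended_ideal J"
        then show "(\<ominus>\<^bsub>S\<^esub> x) \<otimes>\<^bsub>S\<^esub> f \<in> extended_ideal J"
          using closed[OF f] neg[of "x \<otimes>\<^bsub>S\<^esub> f"] by (simp add: S.l_neg_mult a_minus_def)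
      qed
      show "mon r a \<in> {x \<in> carrier S. x \<otimes>\<^bsub>S\<^esub> f \<in> extended_ideal J}" if "r \<in> carrier R" "a \<in> \<Gamma>" for r a
        using that closed[OF f] act_J[OF that(2)]
        by (auto simp: mon_closed coeff_mon_mult intro!: coeffI J.l_closed)
    qed
    then show "g \<otimes>\<^bsub>S\<^esub> f \<in> extended_ideal J" by simp
    have "g \<in> {x \<in> carrier S. f \<otimes>\<^bsub>S\<^esub> x \<in> extended_ideal J}"
    proof (rule monomials_generate[OF _ _ g])
      show "additive_subgroup {x \<in> carrier S. f \<otimes>\<^bsub>S\<^esub> x \<in> extended_ideal J} S"
      proof (rule S.additive_subgroup_criterion; clarsimp simp: closed[OF f])
        show "f \<otimes>\<^bsub>S\<^esub> \<zero>\<^bsub>S\<^esub> \<in> extended_ideal J"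
          using closed[OF f] additive_subgroup.zero_closed[OF E] by (simp add: S.r_null)
      next
        fix x y assume "x \<in> carrier S" "y \<in> carrier S" "f \<otimes>\<^bsub>S\<^esub> x \<in> extended_ideal J" "f \<otimes>\<^bsub>S\<^esub> y \<in> extended_ideal J"
        then show "f \<otimes>\<^bsub>S\<^esub> (x \<oplus>\<^bsub>S\<^esub> y) \<in> extended_ideal J"
          using closed[OF f] by (simp add: S.r_distr add)
      next
        fix x assume "x \<in> carrier S" "f \<otimes>\<^bsub>S\<^esub> x \<in> extended_ideal J"
        then show "f \<otimes>\<^bsub>S\<^esub> (\<ominus>\<^bsub>S\<^esub> x) \<in> extended_ideal J"
          using closed[OF f] neg[of "f \<otimes>\<^bsub>S\<^esub> x"] by (simp add: S.r_neg_mult a_minus_def)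
      qed
      show "mon r a \<in> {x \<in> carrier S. f \<otimes>\<^bsub>S\<^esub> x \<in> extended_ideal J}" if "r \<in> carrier R" "a \<in> \<Gamma>" for r a
        using that closed[OF f]
        by (auto simp: mon_closed coeff_mult_mon act_closed grade_diff intro!: coeffI J.r_closed)
    qed
    then show "f \<otimes>\<^bsub>S\<^esub> g \<in> extended_ideal J" by simp
  qed
qed

text \<open>Monomials of degree zero recover \<open>J\<close> from its extension: a zero extension
  makes every \<open>mon j 0\<close> zero, and a full one contains
  \<open>mon \<one> 0\<close>.\<close>

lemma simple_imp_invariant_ideal_trivial:
  assumes S: "nonassoc_simple S"
    and J: "nonassoc_ideal J R" and inv: "\<And>a. a \<in> \<Gamma> \<Longrightarrow> act a ` J = J"
  shows "J = {\<zero>} \<or> J = carrier R"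
proof -
  interpret J: nonassoc_ideal J R by fact
  have "extended_ideal J = {\<zero>\<^bsub>S\<^esub>} \<or> extended_ideal J = carrier S"
    using S nonassoc_ideal_extended[OF J inv] by (simp add: nonassoc_simple_def)
  then show ?thesis
  proof
    assume E: "extended_ideal J = {\<zero>\<^bsub>S\<^esub>}"
    have "j = \<zero>" if "j \<in> J" for j
    proof -
      have "mon j 0 \<in> extended_ideal J"
        using that by (simp add: extended_ideal_def mon_closed coeff_mon grade_zero J.a_Hcarr)
      then have "coeff (mon j 0) 0 = \<zero>" by (simp add: E coeff_zero)
      then show ?thesis using that by (simp add: coeff_mon grade_zero J.a_Hcarr)
    qed
    then show ?thesis using J.zero_closed by blast
  next
    assume E: "extended_ideal J = carrier S"
    have "mon \<one> 0 \<in> extended_ideal J" using E by (simp add: mon_closed grade_zero)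
    then have "coeff (mon \<one> 0) 0 \<in> J" by (simp add: extended_ideal_def)
    then have "\<one> \<in> J" by (simp add: coeff_mon grade_zero)
    then show ?thesis using R.nonassoc_ideal_eq_carrier[OF J] by blast
  qed
qed

section \<open>Inner pairs and the ideal they produce\<close>

text \<open>Condition (ii) is imposed on every \<open>act a\<close>, since the abstract setting has
  no chosen generators; \<open>commutes_with_right_mult_iff\<close> translates it back to the single
  \<open>\<sigma> i\<close>.\<close>

definition inner_pair :: "'a \<Rightarrow> 'g \<Rightarrow> bool" where
  "inner_pair u m \<longleftrightarrow> u \<in> middle_nucleus R \<inter> right_nucleus R \<inter> nonassoc_units R \<and>
     m \<in> \<Gamma> \<and> (\<forall>r\<in>carrier R. act m r = (inv u \<otimes> r) \<otimes> u \<and>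
       (\<forall>a\<in>\<Gamma>. act a (r \<otimes> u) = act a r \<otimes> u))"

text \<open>By \<open>torsion\<close> the multiples of \<open>m\<close>, written as iterates of
  \<open>(+) m\<close>, are pairwise distinct. As elements of \<open>S\<close> have finite support,
  this keeps the identity out of the ideal generated by the identity minus
  \<open>mon u m\<close>.\<close>

lemma inner_pair_not_simple:
  assumes S: "nonassoc_simple S" and um: "inner_pair u m" and m0: "m \<noteq> 0"
    and torsion: "\<And>m. \<lbrakk>m \<in> \<Gamma>; m \<noteq> 0\<rbrakk> \<Longrightarrow> inj (\<lambda>k. ((+) m ^^ k) 0)"
  shows False
proof -
  have nuc: "u \<in> middle_nucleus R" "u \<in> right_nucleus R" "u \<in> nonassoc_units R" and m: "m \<in> \<Gamma>"
    and conj: "\<And>r. r \<in> carrier R \<Longrightarrow> act m r = (inv u \<otimes> r) \<otimes> u"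
    and act_u: "\<And>r a. \<lbrakk>r \<in> carrier R; a \<in> \<Gamma>\<rbrakk> \<Longrightarrow> act a (r \<otimes> u) = act a r \<otimes> u"
    using um by (auto simp: inner_pair_def)
  note inv_u = R.inv_middle_nucleus(1-3)[OF nuc(1,3)]
  have u: "u \<in> carrier R" using nuc by (simp add: middle_nucleus_def)
  have mid: "(r \<otimes> u) \<otimes> s = r \<otimes> (u \<otimes> s)" if "r \<in> carrier R" "s \<in> carrier R" for r s
    using R.associator_zeroD[of r u s] nuc(1) that u by (simp add: middle_nucleus_def)
  have right: "(r \<otimes> s) \<otimes> u = r \<otimes> (s \<otimes> u)" if "r \<in> carrier R" "s \<in> carrier R" for r s
    using R.associator_zeroD[of r s u] nuc(2) that u by (simp add: right_nucleus_def)
  have r_cancel: "(r \<otimes> u) \<otimes> inv u = r" "(r \<otimes> inv u) \<otimes> u = r" if "r \<in> carrier R" for r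
    using that u inv_u by (simp_all add: mid right)
  have l_cancel: "inv u \<otimes> (u \<otimes> r) = r" if "r \<in> carrier R" for r
    using mid[of "inv u" r] that inv_u by simp
  \<comment> \<open>The other side of \<open>l_cancel\<close> is not formal; it comes from the injectivity of \<open>act m\<close>.\<close>
  have l_cancel': "u \<otimes> (inv u \<otimes> r) = r" if r: "r \<in> carrier R" for r
  proof (rule act_inject[OF m _ r])
    show "u \<otimes> (inv u \<otimes> r) \<in> carrier R" using r u inv_u by simp
    show "act m (u \<otimes> (inv u \<otimes> r)) = act m r"
      using r u inv_u by (simp add: conj l_cancel)
  qed
  \<comment> \<open>Condition (i) freed of the inverse; from here on it enters only in this
    form.\<close>
  have comm: "u \<otimes> act m r = r \<otimes> u" if "r \<in> carrier R" for r
  proof -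
    have "u \<otimes> ((inv u \<otimes> r) \<otimes> u) = (u \<otimes> (inv u \<otimes> r)) \<otimes> u"
      using that u inv_u by (simp add: right)
    then show ?thesis using that by (simp add: conj l_cancel')
  qed
  \<comment> \<open>This is (ii) at \<open>r = \<one>\<close>. Since \<open>u\<close> is fixed,
    right multiplication by \<open>w\<close> multiplies coefficients by \<open>u\<close> without a
    twist.\<close>
  have fix_u: "act a u = u" if "a \<in> \<Gamma>" for a
    using act_u[OF R.one_closed that] that u by (simp add: act_one)
  define w where "w = mon u m"
  have w: "w \<in> carrier S" using u m by (simp add: w_def mon_closed)
  have xw: "coeff (x \<otimes>\<^bsub>S\<^esub> w) b = coeff x (b - m) \<otimes> u" if "x \<in> carrier S" "b \<in> \<Gamma>" for x b
    using that u m by (simp add: w_def coeff_mult_mon fix_u grade_diff)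
  have central: "w \<otimes>\<^bsub>S\<^esub> x = x \<otimes>\<^bsub>S\<^esub> w" if "x \<in> carrier S" for x
  proof (rule coeff_inject)
    fix b assume b: "b \<in> \<Gamma>"
    show "coeff (w \<otimes>\<^bsub>S\<^esub> x) b = coeff (x \<otimes>\<^bsub>S\<^esub> w) b"
      using that u m b by (simp add: xw comm coeff_closed) (simp add: w_def coeff_mon_mult comm coeff_closed)
  qed (use that w in auto)
  \<comment> \<open>Two additive maps agree on a subgroup, so both nucleus identities can be tested
    on monomials \<open>x\<close>.\<close>
  have subgroup: "additive_subgroup {x \<in> carrier S. h x = k x} S"
    if "\<And>x. x \<in> carrier S \<Longrightarrow> h x \<in> carrier S" "\<And>x. x \<in> carrier S \<Longrightarrow> k x \<in> carrier S"
      and "\<And>x y. \<lbrakk>x \<in> carrier S; y \<in> carrier S\<rbrakk> \<Longrightarrow> h (x \<oplus>\<^bsub>S\<^esub> y) = h x \<oplus>\<^bsub>S\<^esub> h y"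
      and "\<And>x y. \<lbrakk>x \<in> carrier S; y \<in> carrier S\<rbrakk> \<Longrightarrow> k (x \<oplus>\<^bsub>S\<^esub> y) = k x \<oplus>\<^bsub>S\<^esub> k y"
    for h k :: "'b \<Rightarrow> 'b"
  proof -
    have zero: "h \<zero>\<^bsub>S\<^esub> = \<zero>\<^bsub>S\<^esub>" "k \<zero>\<^bsub>S\<^esub> = \<zero>\<^bsub>S\<^esub>"
      using that(1)[of "\<zero>\<^bsub>S\<^esub>"] that(2)[of "\<zero>\<^bsub>S\<^esub>"] that(3,4)[of "\<zero>\<^bsub>S\<^esub>" "\<zero>\<^bsub>S\<^esub>"]
      by (simp_all add: S.add.r_cancel_one')
    have "h (\<ominus>\<^bsub>S\<^esub> x) = \<ominus>\<^bsub>S\<^esub> h x" "k (\<ominus>\<^bsub>S\<^esub> x) = \<ominus>\<^bsub>S\<^esub> k x" if x: "x \<in> carrier S" for x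
      using \<open>\<And>x y. \<lbrakk>x \<in> carrier S; y \<in> carrier S\<rbrakk> \<Longrightarrow> h (x \<oplus>\<^bsub>S\<^esub> y) = h x \<oplus>\<^bsub>S\<^esub> h y\<close>[of "\<ominus>\<^bsub>S\<^esub> x" x]
        \<open>\<And>x y. \<lbrakk>x \<in> carrier S; y \<in> carrier S\<rbrakk> \<Longrightarrow> k (x \<oplus>\<^bsub>S\<^esub> y) = k x \<oplus>\<^bsub>S\<^esub> k y\<close>[of "\<ominus>\<^bsub>S\<^esub> x" x]
        S.minus_equality[of "h (\<ominus>\<^bsub>S\<^esub> x)" "h x"] S.minus_equality[of "k (\<ominus>\<^bsub>S\<^esub> x)" "k x"]
        \<open>\<And>x. x \<in> carrier S \<Longrightarrow> h x \<in> carrier S\<close> \<open>\<And>x. x \<in> carrier S \<Longrightarrow> k x \<in> carrier S\<close> x zero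
      by (simp_all add: S.l_neg)
    then show ?thesis
      using that zero by (intro S.additive_subgroup_criterion) auto
  qed
  have nuc_r: "(x \<otimes>\<^bsub>S\<^esub> y) \<otimes>\<^bsub>S\<^esub> w = x \<otimes>\<^bsub>S\<^esub> (y \<otimes>\<^bsub>S\<^esub> w)" if x: "x \<in> carrier S" and y: "y \<in> carrier S" for x y
  proof -
    have "x \<in> {x \<in> carrier S. (x \<otimes>\<^bsub>S\<^esub> y) \<otimes>\<^bsub>S\<^esub> w = x \<otimes>\<^bsub>S\<^esub> (y \<otimes>\<^bsub>S\<^esub> w)}"
    proof (rule monomials_generate[OF _ _ x])
      show "additive_subgroup {x \<in> carrier S. (x \<otimes>\<^bsub>S\<^esub> y) \<otimes>\<^bsub>S\<^esub> w = x \<otimes>\<^bsub>S\<^esub> (y \<otimes>\<^bsub>S\<^esub> w)} S"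
        using y w by (intro subgroup) (auto simp: S.l_distr)
      fix r a assume r: "r \<in> carrier R" and a: "a \<in> \<Gamma>"
      \<comment> \<open>In each degree, (ii) moves \<open>u\<close> out of \<open>act a\<close> and
        the right nucleus shifts the brackets.\<close>
      have "(mon r a \<otimes>\<^bsub>S\<^esub> y) \<otimes>\<^bsub>S\<^esub> w = mon r a \<otimes>\<^bsub>S\<^esub> (y \<otimes>\<^bsub>S\<^esub> w)"
      proof (rule coeff_inject)
        fix b assume b: "b \<in> \<Gamma>"
        then show "coeff ((mon r a \<otimes>\<^bsub>S\<^esub> y) \<otimes>\<^bsub>S\<^esub> w) b = coeff (mon r a \<otimes>\<^bsub>S\<^esub> (y \<otimes>\<^bsub>S\<^esub> w)) b"
          using r a y w m u
          by (simp add: xw coeff_mon_mult mon_closed grade_diff act_u coeff_closed right act_closed diff_right_commute)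
      qed (use r a y w in \<open>auto simp: mon_closed\<close>)
      then show "mon r a \<in> {x \<in> carrier S. (x \<otimes>\<^bsub>S\<^esub> y) \<otimes>\<^bsub>S\<^esub> w = x \<otimes>\<^bsub>S\<^esub> (y \<otimes>\<^bsub>S\<^esub> w)}"
        using r a by (simp add: mon_closed)
    qed
    then show ?thesis by simp
  qed
  have nuc_m: "(x \<otimes>\<^bsub>S\<^esub> w) \<otimes>\<^bsub>S\<^esub> y = x \<otimes>\<^bsub>S\<^esub> (w \<otimes>\<^bsub>S\<^esub> y)" if x: "x \<in> carrier S" and y: "y \<in> carrier S" for x y
  proof -
    have "x \<in> {x \<in> carrier S. (x \<otimes>\<^bsub>S\<^esub> w) \<otimes>\<^bsub>S\<^esub> y = x \<otimes>\<^bsub>S\<^esub> (w \<otimes>\<^bsub>S\<^esub> y)}"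
    proof (rule monomials_generate[OF _ _ x])
      show "additive_subgroup {x \<in> carrier S. (x \<otimes>\<^bsub>S\<^esub> w) \<otimes>\<^bsub>S\<^esub> y = x \<otimes>\<^bsub>S\<^esub> (w \<otimes>\<^bsub>S\<^esub> y)} S"
        using y w by (intro subgroup) (auto simp: S.l_distr)
      fix r a assume r: "r \<in> carrier R" and a: "a \<in> \<Gamma>"
      \<comment> \<open>The factor \<open>u\<close> passes \<open>act a\<close> unchanged, so the
        product is a single monomial.\<close>
      have rw: "mon r a \<otimes>\<^bsub>S\<^esub> w = mon (r \<otimes> u) (a + m)"
      proof (rule coeff_inject)
        fix b assume b: "b \<in> \<Gamma>"
        have "b - m = a \<longleftrightarrow> b = a + m" by (auto simp: algebra_simps)
        then show "coeff (mon r a \<otimes>\<^bsub>S\<^esub> w) b = coeff (mon (r \<otimes> u) (a + m)) b"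
          using r a m u w b by (simp add: xw mon_closed coeff_mon grade_add R.l_null)
      qed (use r a m u w in \<open>auto simp: mon_closed grade_add\<close>)
      \<comment> \<open>On the right \<open>y\<close> is written before \<open>w\<close>, where
        \<open>xw\<close> gives the coefficients; \<open>central\<close> restores the order at the
        end.\<close>
      have "(mon r a \<otimes>\<^bsub>S\<^esub> w) \<otimes>\<^bsub>S\<^esub> y = mon r a \<otimes>\<^bsub>S\<^esub> (y \<otimes>\<^bsub>S\<^esub> w)"
      proof (rule coeff_inject)
        fix b assume b: "b \<in> \<Gamma>"
        define t where "t = coeff y (b - a - m)"
        have t: "t \<in> carrier R" using y by (simp add: t_def coeff_closed)
        have "coeff ((mon r a \<otimes>\<^bsub>S\<^esub> w) \<otimes>\<^bsub>S\<^esub> y) b = (r \<otimes> u) \<otimes> act (m + a) t"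
          using r a m u y b by (simp add: rw coeff_mon_mult grade_add t_def diff_diff_eq add.commute)
        also have "\<dots> = r \<otimes> (u \<otimes> act m (act a t))"
          using r u t a m by (simp add: mid act_closed act_add)
        also have "\<dots> = r \<otimes> act a (t \<otimes> u)"
          using t a by (simp add: comm act_closed act_u)
        also have "\<dots> = coeff (mon r a \<otimes>\<^bsub>S\<^esub> (y \<otimes>\<^bsub>S\<^esub> w)) b"
          using r a y w b by (simp add: coeff_mon_mult xw grade_diff t_def)
        finally show "coeff ((mon r a \<otimes>\<^bsub>S\<^esub> w) \<otimes>\<^bsub>S\<^esub> y) b = coeff (mon r a \<otimes>\<^bsub>S\<^esub> (y \<otimes>\<^bsub>S\<^esub> w)) b" .
      qed (use r a y w in \<open>auto simp: mon_closed\<close>)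
      then show "mon r a \<in> {x \<in> carrier S. (x \<otimes>\<^bsub>S\<^esub> w) \<otimes>\<^bsub>S\<^esub> y = x \<otimes>\<^bsub>S\<^esub> (w \<otimes>\<^bsub>S\<^esub> y)}"
        using r a y by (simp add: mon_closed central)
    qed
    then show ?thesis by simp
  qed
  define I where "I = (\<lambda>x. x \<ominus>\<^bsub>S\<^esub> x \<otimes>\<^bsub>S\<^esub> w) ` carrier S"
  have "additive_subgroup I S"
  proof (rule S.additive_subgroup_criterion)
    show "I \<subseteq> carrier S" using w by (auto simp: I_def)
    show "\<zero>\<^bsub>S\<^esub> \<in> I"
      using w by (auto simp: I_def image_iff S.l_null S.minus_self intro!: bexI[of _ "\<zero>\<^bsub>S\<^esub>"])
  next
    fix f g assume "f \<in> I" "g \<in> I"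
    then obtain x y where xy: "x \<in> carrier S" "y \<in> carrier S"
      "f = x \<ominus>\<^bsub>S\<^esub> x \<otimes>\<^bsub>S\<^esub> w" "g = y \<ominus>\<^bsub>S\<^esub> y \<otimes>\<^bsub>S\<^esub> w" by (auto simp: I_def)
    then have "f \<oplus>\<^bsub>S\<^esub> g = (x \<oplus>\<^bsub>S\<^esub> y) \<ominus>\<^bsub>S\<^esub> (x \<oplus>\<^bsub>S\<^esub> y) \<otimes>\<^bsub>S\<^esub> w"
      using w by (simp add: a_minus_def S.l_distr S.minus_add S.a_ac)
    then show "f \<oplus>\<^bsub>S\<^esub> g \<in> I" using xy by (auto simp: I_def)
  next
    fix f assume "f \<in> I"
    then obtain x where x: "x \<in> carrier S" "f = x \<ominus>\<^bsub>S\<^esub> x \<otimes>\<^bsub>S\<^esub> w" by (auto simp: I_def)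
    then have "\<ominus>\<^bsub>S\<^esub> f = (\<ominus>\<^bsub>S\<^esub> x) \<ominus>\<^bsub>S\<^esub> (\<ominus>\<^bsub>S\<^esub> x) \<otimes>\<^bsub>S\<^esub> w"
      using w by (simp add: a_minus_def S.l_neg_mult S.minus_add)
    then show "\<ominus>\<^bsub>S\<^esub> f \<in> I" using x by (auto simp: I_def)
  qed
  then have I: "nonassoc_ideal I S"
  proof (rule S.nonassoc_idealI)
    fix f y assume "f \<in> I" and y: "y \<in> carrier S"
    then obtain x where x: "x \<in> carrier S" "f = x \<ominus>\<^bsub>S\<^esub> x \<otimes>\<^bsub>S\<^esub> w" by (auto simp: I_def)
    have "y \<otimes>\<^bsub>S\<^esub> f = y \<otimes>\<^bsub>S\<^esub> x \<ominus>\<^bsub>S\<^esub> (y \<otimes>\<^bsub>S\<^esub> x) \<otimes>\<^bsub>S\<^esub> w"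
      using x y w by (simp add: S.r_distr_minus nuc_r)
    then show "y \<otimes>\<^bsub>S\<^esub> f \<in> I" using x y by (auto simp: I_def)
    \<comment> \<open>Here \<open>(x w) y = x (w y) = x (y w) = (x y) w\<close> by the middle
      nucleus, centrality and the right nucleus.\<close>
    have "f \<otimes>\<^bsub>S\<^esub> y = x \<otimes>\<^bsub>S\<^esub> y \<ominus>\<^bsub>S\<^esub> (x \<otimes>\<^bsub>S\<^esub> y) \<otimes>\<^bsub>S\<^esub> w"
      using x y w by (simp add: S.l_distr_minus nuc_m nuc_r central)
    then show "f \<otimes>\<^bsub>S\<^esub> y \<in> I" using x y by (auto simp: I_def)
  qed
  have one: "\<one> \<noteq> \<zero>"
  proof
    assume "\<one> = \<zero>"
    then have "carrier R = {\<zero>}" by (rule R.carrier_trivial)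
    then have "f = \<zero>\<^bsub>S\<^esub>" if "f \<in> carrier S" for f
      using coeff_closed[OF that] by (intro eq_zeroI[OF that]) auto
    then have "carrier S = {\<zero>\<^bsub>S\<^esub>}" by blast
    then show False using S by (simp add: nonassoc_simple_def)
  qed
  have "mon \<one> 0 \<ominus>\<^bsub>S\<^esub> mon \<one> 0 \<otimes>\<^bsub>S\<^esub> w \<in> I"
    by (auto simp: I_def mon_closed grade_zero)
  \<comment> \<open>The term containing \<open>w\<close> sits in degree \<open>m\<close>, which is
    not \<open>0\<close>.\<close>
  moreover have "coeff (mon \<one> 0 \<ominus>\<^bsub>S\<^esub> mon \<one> 0 \<otimes>\<^bsub>S\<^esub> w) 0 = \<one>"
    using m0 w u by (simp add: coeff_minus mon_closed grade_zero coeff_mon xw R.l_null) (simp add: a_minus_def)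
  ultimately have "I \<noteq> {\<zero>\<^bsub>S\<^esub>}" using one by (auto simp: coeff_zero)
  then have "I = carrier S" using S I unfolding nonassoc_simple_def by blast
  then have "mon \<one> 0 \<in> I" by (simp add: mon_closed grade_zero)
  then obtain s where s: "s \<in> carrier S" "mon \<one> 0 = s \<ominus>\<^bsub>S\<^esub> s \<otimes>\<^bsub>S\<^esub> w" by (auto simp: I_def)
  \<comment> \<open>Comparing coefficients along the line \<open>\<int> m\<close> forces \<open>s\<close> to have infinite support.\<close>
  have step: "(if b = 0 then \<one> else \<zero>) = coeff s b \<ominus> coeff s (b - m) \<otimes> u" if "b \<in> \<Gamma>" for b
    using arg_cong[OF s(2), of "\<lambda>f. coeff f b"] s(1) w that
    by (simp add: coeff_minus coeff_mon grade_zero xw)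
  have zero_iff: "r \<otimes> u = \<zero> \<longleftrightarrow> r = \<zero>" if "r \<in> carrier R" for r
    using r_cancel(1)[OF that] that u inv_u by (auto simp: R.l_null)
  \<comment> \<open>Away from degree \<open>0\<close> the equation reads
    \<open>coeff s b = coeff s (b - m) \<otimes> u\<close>, and right multiplication by
    \<open>u\<close> is injective.\<close>
  have shift: "coeff s b = \<zero> \<longleftrightarrow> coeff s (b - m) = \<zero>" if "b \<in> \<Gamma>" "b \<noteq> 0" for b
  proof -
    have "coeff s b = coeff s (b - m) \<otimes> u"
      using step[OF that(1)] that(2) s u by (simp add: coeff_closed R.minus_eq_zeroD)
    then show ?thesis using s by (simp add: zero_iff coeff_closed)
  qed
  have walk: "coeff s (((+) p ^^ k) c) \<noteq> \<zero>"
    if "p \<in> \<Gamma>" "c \<in> \<Gamma>" "coeff s c \<noteq> \<zero>"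
      and "\<And>j. coeff s (((+) p ^^ j) c) \<noteq> \<zero> \<Longrightarrow> coeff s (((+) p ^^ Suc j) c) \<noteq> \<zero>" for p c k
    using that by (induction k) auto
  \<comment> \<open>Iterates from \<open>c\<close> are translates of iterates from \<open>0\<close>,
    for which \<open>torsion\<close> is stated.\<close>
  have pow: "((+) p ^^ k) c = ((+) p ^^ k) 0 + c" for p c :: 'g and k
    by (induction k) (auto simp: algebra_simps)
  have pow_G: "((+) p ^^ k) 0 \<in> \<Gamma>" if "p \<in> \<Gamma>" for p k
    using that by (induction k) (auto simp: grade_zero grade_add)
  have infinite: False if "p \<in> \<Gamma>" "p \<noteq> 0" "\<And>k. coeff s (((+) p ^^ k) c) \<noteq> \<zero>" for p c
  proof -
    have "inj (\<lambda>k. ((+) p ^^ k) c)"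
      using torsion[OF that(1,2)] by (subst pow) (auto simp: inj_def)
    then have "infinite (range (\<lambda>k. ((+) p ^^ k) c))" by (meson finite_imageD infinite_UNIV_nat)
    moreover have "range (\<lambda>k. ((+) p ^^ k) c) \<subseteq> {b. coeff s b \<noteq> \<zero>}" using that by auto
    ultimately show False using finite_support[OF s(1)] finite_subset by blast
  qed
  \<comment> \<open>Degree \<open>0\<close> is excluded in \<open>shift\<close>; no positive
    multiple of \<open>p\<close> meets it.\<close>
  have ne: "((+) p ^^ Suc j) 0 \<noteq> 0" if "p \<in> \<Gamma>" "p \<noteq> 0" for p j
    using torsion[OF that, THEN injD, of "Suc j" 0] by auto
  \<comment> \<open>A non-zero coefficient at \<open>0\<close> propagates along the positive
    multiples of \<open>m\<close>. If it is zero, the equation at \<open>0\<close> forces a non-zero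
    coefficient at \<open>- m\<close>, which propagates in the opposite direction.\<close>
  show False
  proof (cases "coeff s 0 = \<zero>")
    case False
    have "coeff s (((+) m ^^ k) 0) \<noteq> \<zero>" for k
    proof (rule walk[OF m grade_zero False])
      fix j assume "coeff s (((+) m ^^ j) 0) \<noteq> \<zero>"
      then show "coeff s (((+) m ^^ Suc j) 0) \<noteq> \<zero>"
        using shift[OF pow_G[OF m, of "Suc j"] ne[OF m m0]] by simp
    qed
    then show False using infinite m m0 by blast
  next
    case True
    have m': "- m \<in> \<Gamma>" "- m \<noteq> 0" using m m0 by (auto simp: grade_minus)
    have "coeff s (- m) \<noteq> \<zero>"
      using step[OF grade_zero] True one u by (auto simp: R.l_null R.minus_self)
    then have "coeff s (((+) (- m) ^^ k) (- m)) \<noteq> \<zero>" for k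
    proof (rule walk[OF m'(1) m'(1)])
      fix j assume *: "coeff s (((+) (- m) ^^ j) (- m)) \<noteq> \<zero>"
      \<comment> \<open>The walk starts at \<open>- m\<close>, so its \<open>j\<close>-th point is
        the multiple \<open>j + 1\<close> of \<open>- m\<close>. It is not \<open>0\<close>, and
        \<open>shift\<close> can be read downwards there.\<close>
      have eq: "((+) (- m) ^^ j) (- m) = ((+) (- m) ^^ Suc j) 0"
        using pow[where p = "- m" and c = "- m" and k = j] by (simp add: algebra_simps)
      have "coeff s (((+) (- m) ^^ Suc j) 0 - m) \<noteq> \<zero>"
        using shift[OF pow_G[OF m'(1), of "Suc j"] ne[OF m']] * eq by simp
      then show "coeff s (((+) (- m) ^^ Suc j) (- m)) \<noteq> \<zero>"
        by (simp add: eq[symmetric] del: funpow.simps) (simp add: algebra_simps)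
    qed
    then show False using infinite m' by blast
  qed
qed

section \<open>Ideals through minimal supports\<close>

text \<open>The element is \<open>X^a g X^(-a)\<close>: the left factor applies \<open>act a\<close>
  and moves the degrees by \<open>a\<close>, and the right factor moves them back without changing
  coefficients, since \<open>act\<close> fixes \<open>\<one>\<close>.\<close>

lemma conjugation_closed:
  assumes I: "nonassoc_ideal I S" and g: "g \<in> I" and a: "a \<in> \<Gamma>"
  obtains h where "h \<in> I" "\<And>b. b \<in> \<Gamma> \<Longrightarrow> coeff h b = act a (coeff g b)"
proof
  interpret I: nonassoc_ideal I S by fact
  have gS: "g \<in> carrier S" using g by (rule I.a_Hcarr)
  show "(mon \<one> a \<otimes>\<^bsub>S\<^esub> g) \<otimes>\<^bsub>S\<^esub> mon \<one> (- a) \<in> I"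
    using g a by (intro I.l_closed I.r_closed) (auto simp: mon_closed grade_minus)
  show "coeff ((mon \<one> a \<otimes>\<^bsub>S\<^esub> g) \<otimes>\<^bsub>S\<^esub> mon \<one> (- a)) b = act a (coeff g b)" if "b \<in> \<Gamma>" for b
    using that a gS
    by (simp add: coeff_mult_mon coeff_mon_mult mon_closed grade_minus grade_add act_one act_closed coeff_closed)
qed

text \<open>A non-zero element of \<open>I\<close> with the fewest non-zero coefficients is shifted
  by a monomial on the right so that one of its degrees becomes \<open>0\<close>. An element
  supported in \<open>A\<close> that also vanishes at some \<open>c \<in> A\<close> has strictly
  smaller support.\<close>

lemma minimal_support:
  assumes I: "nonassoc_ideal I S" and nz: "I \<noteq> {\<zero>\<^bsub>S\<^esub>}"
  obtains A f where "finite A" "0 \<in> A" "A \<subseteq> \<Gamma>" "f \<in> I" "{a. coeff f a \<noteq> \<zero>} = A"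
    "\<And>g c. \<lbrakk>g \<in> I; {a. coeff g a \<noteq> \<zero>} \<subseteq> A; c \<in> A; coeff g c = \<zero>\<rbrakk> \<Longrightarrow> g = \<zero>\<^bsub>S\<^esub>"
proof -
  interpret I: nonassoc_ideal I S by fact
  let ?supp = "\<lambda>f. {a. coeff f a \<noteq> \<zero>}"
  let ?P = "\<lambda>f. f \<in> I \<and> f \<noteq> \<zero>\<^bsub>S\<^esub>"
  have "\<exists>f. ?P f" using nz I.zero_closed by blast
  then obtain f0 where f0: "?P f0" "\<And>g. ?P g \<Longrightarrow> card (?supp f0) \<le> card (?supp g)"
    using ex_has_least_nat[of ?P _ "\<lambda>f. card (?supp f)"] by blast
  have f0S: "f0 \<in> carrier S" using f0(1) I.a_Hcarr by blast
  obtain b where b: "b \<in> \<Gamma>" "coeff f0 b \<noteq> \<zero>"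
    using eq_zeroI[OF f0S] f0(1) by blast
  define f where "f = f0 \<otimes>\<^bsub>S\<^esub> mon \<one> (- b)"
  have f: "f \<in> I" "f \<in> carrier S"
    using f0(1) f0S b by (auto simp: f_def mon_closed grade_minus intro!: I.r_closed)
  have coeff_f: "coeff f c = coeff f0 (c + b)" if "c \<in> \<Gamma>" for c
    using that b f0S by (simp add: f_def coeff_mult_mon grade_minus grade_add act_one coeff_closed)
  \<comment> \<open>The shift embeds the new support into the old one, so its size is still
    minimal.\<close>
  have "(\<lambda>c. c + b) ` ?supp f \<subseteq> ?supp f0"
  proof (clarsimp)
    fix c assume c: "coeff f c \<noteq> \<zero>" "coeff f0 (c + b) = \<zero>"
    then have "c \<in> \<Gamma>" using coeff_outside[OF f(2)] by blast
    then show False using c coeff_f by simp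
  qed
  then have "card (?supp f) \<le> card (?supp f0)"
    using finite_support[OF f0S] card_inj_on_le[of "\<lambda>c. c + b" "?supp f" "?supp f0"] by simp
  then have le: "card (?supp f) \<le> card (?supp g)" if "?P g" for g
    using f0(2)[OF that] by simp
  have "g = \<zero>\<^bsub>S\<^esub>" if "g \<in> I" "?supp g \<subseteq> ?supp f" "c \<in> ?supp f" "coeff g c = \<zero>" for g c
  proof (rule ccontr)
    assume "g \<noteq> \<zero>\<^bsub>S\<^esub>"
    then have "card (?supp f) \<le> card (?supp g)" using le that(1) by blast
    moreover have "?supp g \<subset> ?supp f" using that by blast
    ultimately show False using psubset_card_mono finite_support[OF f(2)] by (meson leD)
  qed
  moreover have "?supp f \<subseteq> \<Gamma>" using coeff_outside[OF f(2)] by blast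
  moreover have "0 \<in> ?supp f" using coeff_f[OF grade_zero] b by simp
  ultimately show ?thesis
    using that[of "?supp f" f] finite_support[OF f(2)] f(1) by blast
qed

lemma simpleI:
  assumes J: "\<And>J. \<lbrakk>nonassoc_ideal J R; \<And>a. a \<in> \<Gamma> \<Longrightarrow> act a ` J = J\<rbrakk> \<Longrightarrow> J = {\<zero>} \<or> J = carrier R"
    and no_pair: "\<And>u m. m \<noteq> 0 \<Longrightarrow> \<not> inner_pair u m"
    and one: "\<one> \<noteq> \<zero>"
  shows "nonassoc_simple S"
proof -
  have "I = carrier S" if I: "nonassoc_ideal I S" and nz: "I \<noteq> {\<zero>\<^bsub>S\<^esub>}" for I
  proof -
    interpret I: nonassoc_ideal I S by fact
    obtain A f where A: "finite A" "0 \<in> A" "A \<subseteq> \<Gamma>" and f: "f \<in> I" "{a. coeff f a \<noteq> \<zero>} = A"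
      and minimal: "\<And>g c. \<lbrakk>g \<in> I; {a. coeff g a \<noteq> \<zero>} \<subseteq> A; c \<in> A; coeff g c = \<zero>\<rbrakk> \<Longrightarrow> g = \<zero>\<^bsub>S\<^esub>"
      using minimal_support[OF I nz] by metis
    \<comment> \<open>By minimality, an element of \<open>IA\<close> is determined by any one of its coefficients in \<open>A\<close>.\<close>
    define IA where "IA = {g \<in> I. \<forall>a. a \<notin> A \<longrightarrow> coeff g a = \<zero>}"
    have IA_I: "g \<in> I" "g \<in> carrier S" if "g \<in> IA" for g
      using that I.a_Hcarr by (auto simp: IA_def)
    \<comment> \<open>The product formulas are available only for degrees in
      \<open>\<Gamma>\<close>; elsewhere coefficients vanish.\<close>
    have IA_iff: "g \<in> IA \<longleftrightarrow> g \<in> I \<and> (\<forall>a\<in>\<Gamma>. a \<notin> A \<longrightarrow> coeff g a = \<zero>)" for g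
      using coeff_outside I.a_Hcarr by (auto simp: IA_def)
    have min: "g = \<zero>\<^bsub>S\<^esub>" if "g \<in> IA" "c \<in> A" "coeff g c = \<zero>" for g c
      using minimal[of g c] that by (auto simp: IA_def)
    have IA_minus: "g \<ominus>\<^bsub>S\<^esub> h \<in> IA" if "g \<in> IA" "h \<in> IA" for g h
      using that S.additive_subgroup_minus_closed[OF I.is_additive_subgroup IA_I(1)[OF that(1)] IA_I(1)[OF that(2)]]
        IA_I(2)[OF that(1)] IA_I(2)[OF that(2)]
      by (simp add: IA_def coeff_minus R.minus_self)
    have IA_eq: "g = h" if "g \<in> IA" "h \<in> IA" "c \<in> A" "coeff g c = coeff h c" for g h c
      using min[OF IA_minus[OF that(1,2)] that(3)] that IA_I[OF that(1)] IA_I[OF that(2)]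
      by (simp add: coeff_minus R.minus_self coeff_closed S.minus_eq_zeroD)
    \<comment> \<open>Factors of degree zero do not enlarge supports, so \<open>IA\<close> is closed
      under them on both sides.\<close>
    have scalar: "mon r 0 \<otimes>\<^bsub>S\<^esub> g \<in> IA" "g \<otimes>\<^bsub>S\<^esub> mon r 0 \<in> IA"
      "\<And>b. b \<in> \<Gamma> \<Longrightarrow> coeff (mon r 0 \<otimes>\<^bsub>S\<^esub> g) b = r \<otimes> coeff g b"
      "\<And>b. b \<in> \<Gamma> \<Longrightarrow> coeff (g \<otimes>\<^bsub>S\<^esub> mon r 0) b = coeff g b \<otimes> act b r"
      if "g \<in> IA" "r \<in> carrier R" for g r
    proof -
      show l: "coeff (mon r 0 \<otimes>\<^bsub>S\<^esub> g) b = r \<otimes> coeff g b" if "b \<in> \<Gamma>" for b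
        using that \<open>r \<in> carrier R\<close> IA_I[OF \<open>g \<in> IA\<close>]
        by (simp add: coeff_mon_mult grade_zero act_0 coeff_closed)
      show r: "coeff (g \<otimes>\<^bsub>S\<^esub> mon r 0) b = coeff g b \<otimes> act b r" if "b \<in> \<Gamma>" for b
        using that \<open>r \<in> carrier R\<close> IA_I[OF \<open>g \<in> IA\<close>]
        by (simp add: coeff_mult_mon grade_zero)
      show "mon r 0 \<otimes>\<^bsub>S\<^esub> g \<in> IA" "g \<otimes>\<^bsub>S\<^esub> mon r 0 \<in> IA"
        using that I.l_closed[of g "mon r 0"] I.r_closed[of g "mon r 0"]
        by (simp_all add: IA_iff l r mon_closed grade_zero R.r_null R.l_null act_closed)
    qed
    have conj: "\<exists>h\<in>IA. \<forall>b\<in>\<Gamma>. coeff h b = act a (coeff g b)" if g: "g \<in> IA" and a: "a \<in> \<Gamma>" for g a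
    proof -
      obtain h where h: "h \<in> I" "\<And>b. b \<in> \<Gamma> \<Longrightarrow> coeff h b = act a (coeff g b)"
        using conjugation_closed[OF I IA_I(1)[OF g] a] by blast
      then have "h \<in> IA" using g a by (simp add: IA_iff act_zero)
      then show ?thesis using h by blast
    qed
    \<comment> \<open>The coefficients at \<open>c\<close> form an invariant ideal, which is
      non-zero because the support of \<open>f\<close> is all of \<open>A\<close>.\<close>
    have unit_coeff: "\<exists>g\<in>IA. coeff g c = \<one>" if c: "c \<in> A" for c
    proof -
      have cG: "c \<in> \<Gamma>" using c A by blast
      define J where "J = (\<lambda>g. coeff g c) ` IA"
      have JR: "J \<subseteq> carrier R" using IA_I by (auto simp: J_def coeff_closed)
      have f_IA: "f \<in> IA" using f by (auto simp: IA_def)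
      have "additive_subgroup J R"
      proof (rule R.additive_subgroup_criterion[OF JR])
        have "f \<ominus>\<^bsub>S\<^esub> f \<in> IA" using IA_minus f_IA by blast
        then have zero: "\<zero>\<^bsub>S\<^esub> \<in> IA" using IA_I f_IA by (simp add: S.minus_self)
        then show "\<zero> \<in> J" by (force simp: J_def coeff_zero)
        have neg: "\<ominus>\<^bsub>S\<^esub> g \<in> IA" if "g \<in> IA" for g
          using IA_minus[OF zero that] IA_I[OF that] by (simp add: a_minus_def)
        show "x \<oplus> y \<in> J" if xy: "x \<in> J" "y \<in> J" for x y
        proof -
          obtain g h where gh: "g \<in> IA" "h \<in> IA" "x = coeff g c" "y = coeff h c"
            using xy by (auto simp: J_def)
          have "g \<oplus>\<^bsub>S\<^esub> h \<in> IA"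
            using IA_minus[OF gh(1) neg[OF gh(2)]] IA_I[OF gh(2)] by (simp add: a_minus_def)
          moreover have "x \<oplus> y = coeff (g \<oplus>\<^bsub>S\<^esub> h) c"
            using gh(3,4) IA_I[OF gh(1)] IA_I[OF gh(2)] by (simp add: coeff_add)
          ultimately show ?thesis unfolding J_def by blast
        qed
        show "\<ominus> x \<in> J" if x: "x \<in> J" for x
        proof -
          obtain g where g: "g \<in> IA" "x = coeff g c" using x by (auto simp: J_def)
          then have "\<ominus> x = coeff (\<ominus>\<^bsub>S\<^esub> g) c" using IA_I[OF g(1)] by (simp add: coeff_neg)
          then show ?thesis using neg[OF g(1)] unfolding J_def by blast
        qed
      qed
      then have "nonassoc_ideal J R"
      proof (rule R.nonassoc_idealI)
        fix x r assume "x \<in> J" and r: "r \<in> carrier R"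
        then obtain g where g: "g \<in> IA" "x = coeff g c" by (auto simp: J_def)
        show "r \<otimes> x \<in> J"
          using g(2) scalar(3)[OF g(1) r cG, symmetric] scalar(1)[OF g(1) r] unfolding J_def by blast
        \<comment> \<open>At degree \<open>c\<close> a right factor of degree zero is twisted by
          \<open>act c\<close>; the twist is undone in advance.\<close>
        have r': "act (- c) r \<in> carrier R" using r cG by (simp add: act_closed grade_minus)
        have "coeff (g \<otimes>\<^bsub>S\<^esub> mon (act (- c) r) 0) c = x \<otimes> r"
          using g r r' cG by (simp add: scalar act_minus)
        then show "x \<otimes> r \<in> J"
          using scalar(2)[OF g(1) r'] unfolding J_def by (metis imageI)
      qed
      moreover have act_J: "act a ` J \<subseteq> J" if a: "a \<in> \<Gamma>" for a
      proof
        fix y assume "y \<in> act a ` J"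
        then obtain g where g: "g \<in> IA" "y = act a (coeff g c)" by (auto simp: J_def)
        then show "y \<in> J" using conj[OF g(1) a] cG unfolding J_def by (metis imageI)
      qed
      \<comment> \<open>The reverse inclusion is \<open>act_J\<close> applied to
        \<open>- a\<close>.\<close>
      moreover have "J \<subseteq> act a ` J" if a: "a \<in> \<Gamma>" for a
      proof
        fix y assume y: "y \<in> J"
        then have "act (- a) y \<in> J" using act_J[OF grade_minus[OF a]] by blast
        moreover have "y = act a (act (- a) y)" using y JR a by (auto simp: act_minus)
        ultimately show "y \<in> act a ` J" by blast
      qed
      ultimately have "J = {\<zero>} \<or> J = carrier R" by (intro J) blast+
      moreover have "coeff f c \<in> J" "coeff f c \<noteq> \<zero>" using f_IA f c by (auto simp: J_def)
      ultimately have "\<one> \<in> J" by auto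
      then show ?thesis by (force simp: J_def)
    qed
    obtain g where g: "g \<in> IA" "coeff g 0 = \<one>" using unit_coeff[OF A(2)] by blast
    note gI = IA_I[OF g(1)]
    have "coeff g m = \<zero>" if m: "m \<in> \<Gamma>" "m \<noteq> 0" for m
    proof (rule ccontr)
      assume nz: "coeff g m \<noteq> \<zero>"
      then have mA: "m \<in> A" using g by (auto simp: IA_def)
      define u where "u = coeff g m"
      have u: "u \<in> carrier R" using gI by (simp add: u_def coeff_closed)
      \<comment> \<open>In this and the next three identities both sides lie in \<open>IA\<close>
        and agree at degree \<open>0\<close>, hence are equal; degree \<open>m\<close> then gives
        the property of \<open>u\<close>.\<close>
      have comm: "r \<otimes> u = u \<otimes> act m r" if r: "r \<in> carrier R" for r
      proof -
        have "mon r 0 \<otimes>\<^bsub>S\<^esub> g = g \<otimes>\<^bsub>S\<^esub> mon r 0"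
          using r g by (intro IA_eq[OF _ _ A(2)] scalar) (simp_all add: scalar grade_zero act_0)
        then have "coeff (mon r 0 \<otimes>\<^bsub>S\<^esub> g) m = coeff (g \<otimes>\<^bsub>S\<^esub> mon r 0) m" by simp
        then show ?thesis using r g m by (simp add: scalar u_def)
      qed
      have right: "(r \<otimes> s) \<otimes> u = r \<otimes> (s \<otimes> u)" if rs: "r \<in> carrier R" "s \<in> carrier R" for r s
      proof -
        have "mon (r \<otimes> s) 0 \<otimes>\<^bsub>S\<^esub> g = mon r 0 \<otimes>\<^bsub>S\<^esub> (mon s 0 \<otimes>\<^bsub>S\<^esub> g)"
          using rs g by (intro IA_eq[OF _ _ A(2)] scalar) (simp_all add: scalar grade_zero)
        then have "coeff (mon (r \<otimes> s) 0 \<otimes>\<^bsub>S\<^esub> g) m = coeff (mon r 0 \<otimes>\<^bsub>S\<^esub> (mon s 0 \<otimes>\<^bsub>S\<^esub> g)) m" by simp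
        then show ?thesis using rs g m by (simp add: scalar u_def)
      qed
      have mid: "(r \<otimes> u) \<otimes> s = r \<otimes> (u \<otimes> s)" if rs: "r \<in> carrier R" "s \<in> carrier R" for r s
      proof -
        \<comment> \<open>A right factor of degree zero appears as itself at degree \<open>0\<close>
          but twisted by \<open>act m\<close> at degree \<open>m\<close>; \<open>t\<close> is chosen
          to become \<open>s\<close> there.\<close>
        define t where "t = act (- m) s"
        have t: "t \<in> carrier R" "act m t = s"
          using rs m by (auto simp: t_def act_closed grade_minus act_minus)
        have "(mon r 0 \<otimes>\<^bsub>S\<^esub> g) \<otimes>\<^bsub>S\<^esub> mon t 0 = mon r 0 \<otimes>\<^bsub>S\<^esub> (g \<otimes>\<^bsub>S\<^esub> mon t 0)"
          using rs t g by (intro IA_eq[OF _ _ A(2)] scalar) (simp_all add: scalar grade_zero act_0)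
        then have "coeff ((mon r 0 \<otimes>\<^bsub>S\<^esub> g) \<otimes>\<^bsub>S\<^esub> mon t 0) m = coeff (mon r 0 \<otimes>\<^bsub>S\<^esub> (g \<otimes>\<^bsub>S\<^esub> mon t 0)) m" by simp
        then show ?thesis using rs t g m by (simp add: scalar u_def)
      qed
      have act_u: "act a (r \<otimes> u) = act a r \<otimes> u" if r: "r \<in> carrier R" and a: "a \<in> \<Gamma>" for r a
      proof -
        obtain h where h: "h \<in> IA" "\<And>b. b \<in> \<Gamma> \<Longrightarrow> coeff h b = act a (coeff (mon r 0 \<otimes>\<^bsub>S\<^esub> g) b)"
          using conj[OF scalar(1)[OF g(1) r] a] by blast
        have "h = mon (act a r) 0 \<otimes>\<^bsub>S\<^esub> g"
          using r a g h(2) by (intro IA_eq[OF h(1) _ A(2)] scalar) (simp_all add: scalar grade_zero act_closed)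
        then have "coeff h m = coeff (mon (act a r) 0 \<otimes>\<^bsub>S\<^esub> g) m" by simp
        then show ?thesis using r a g m h(2) by (simp add: scalar u_def act_closed)
      qed
      \<comment> \<open>An element normalized at \<open>m\<close> is \<open>g\<close> multiplied on
        the left by its own coefficient \<open>v\<close> at \<open>0\<close>. So \<open>v\<close> is
        a left inverse of \<open>u\<close>, and \<open>comm\<close> makes \<open>act m v\<close> a
        right inverse.\<close>
      obtain h where h: "h \<in> IA" "coeff h m = \<one>" using unit_coeff[OF mA] by blast
      define v where "v = coeff h 0"
      have v: "v \<in> carrier R" using IA_I[OF h(1)] by (simp add: v_def coeff_closed)
      have "h = mon v 0 \<otimes>\<^bsub>S\<^esub> g"
        using v g h by (intro IA_eq[OF h(1) _ A(2)] scalar) (simp_all add: scalar grade_zero v_def)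
      then have vu: "v \<otimes> u = \<one>" using h g v m by (simp add: scalar u_def)
      have nuc: "u \<in> middle_nucleus R" "u \<in> right_nucleus R" "u \<in> nonassoc_units R"
        using u v vu comm[OF v] mid right act_closed[OF m(1) v]
        by (auto simp: middle_nucleus_def right_nucleus_def nonassoc_units_def intro!: R.associator_eq_zero)
      note inv_u = R.inv_middle_nucleus(1-3)[OF nuc(1,3)]
      have "act m r = (inv u \<otimes> r) \<otimes> u" if r: "r \<in> carrier R" for r
      proof -
        have "(inv u \<otimes> r) \<otimes> u = inv u \<otimes> (u \<otimes> act m r)"
          using right[of "inv u" r] comm[OF r] r inv_u by simp
        also have "\<dots> = (inv u \<otimes> u) \<otimes> act m r"
          using mid[OF inv_u(1) act_closed[OF m(1) r]] by (rule sym)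
        finally show ?thesis using r m inv_u by (simp add: act_closed)
      qed
      then have "inner_pair u m" using nuc act_u m by (simp add: inner_pair_def)
      then show False using no_pair m by blast
    qed
    then have "g = mon \<one> 0"
      using gI g by (intro coeff_inject) (auto simp: mon_closed grade_zero coeff_mon)
    then show ?thesis
      using S.nonassoc_ideal_eq_carrier[OF I] gI by (simp add: one_eq_mon)
  qed
  moreover have "coeff \<one>\<^bsub>S\<^esub> 0 = \<one>" by (simp add: one_eq_mon coeff_mon grade_zero)
  then have "carrier S \<noteq> {\<zero>\<^bsub>S\<^esub>}" using one coeff_zero S.one_closed by (metis singletonD)
  ultimately show ?thesis unfolding nonassoc_simple_def by blast
qed

section \<open>The criterion for graded rings\<close>

text \<open>The right side has to exclude the zero ring, which is not simple;
  \<open>nontrivial\<close> supplies the degree of a forbidden pair there.\<close>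

theorem simple_iff:
  assumes torsion: "\<And>m. \<lbrakk>m \<in> \<Gamma>; m \<noteq> 0\<rbrakk> \<Longrightarrow> inj (\<lambda>k. ((+) m ^^ k) 0)"
    and nontrivial: "\<exists>m\<in>\<Gamma>. m \<noteq> 0"
  shows "nonassoc_simple S \<longleftrightarrow>
    (\<forall>J. nonassoc_ideal J R \<and> (\<forall>a\<in>\<Gamma>. act a ` J = J) \<longrightarrow> J = {\<zero>} \<or> J = carrier R) \<and>
    \<not> (\<exists>u m. m \<noteq> 0 \<and> inner_pair u m)"
proof
  assume S: "nonassoc_simple S"
  show "(\<forall>J. nonassoc_ideal J R \<and> (\<forall>a\<in>\<Gamma>. act a ` J = J) \<longrightarrow> J = {\<zero>} \<or> J = carrier R) \<and>
    \<not> (\<exists>u m. m \<noteq> 0 \<and> inner_pair u m)"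
  proof (intro conjI allI impI notI; (elim conjE exE)?)
    show "J = {\<zero>} \<or> J = carrier R" if "nonassoc_ideal J R" "\<forall>a\<in>\<Gamma>. act a ` J = J" for J
      using that by (intro simple_imp_invariant_ideal_trivial[OF S]) auto
    show False if "m \<noteq> 0" "inner_pair u m" for u m
      by (rule inner_pair_not_simple[OF S that(2,1) torsion])
  qed
next
  assume rhs: "(\<forall>J. nonassoc_ideal J R \<and> (\<forall>a\<in>\<Gamma>. act a ` J = J) \<longrightarrow> J = {\<zero>} \<or> J = carrier R) \<and>
    \<not> (\<exists>u m. m \<noteq> 0 \<and> inner_pair u m)"
  have "\<one> \<noteq> \<zero>"
  proof
    \<comment> \<open>In the zero ring \<open>0\<close> is a unit, and every degree forms an inner pair with it.\<close>
    assume "\<one> = \<zero>"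
    then have R0: "carrier R = {\<zero>}" by (rule R.carrier_trivial)
    then have all: "x = \<zero>" if "x \<in> carrier R" for x using that by blast
    have nuc: "\<zero> \<in> middle_nucleus R" "\<zero> \<in> right_nucleus R" "\<zero> \<in> nonassoc_units R"
      using \<open>\<one> = \<zero>\<close>
      by (auto simp: middle_nucleus_def right_nucleus_def nonassoc_units_def R0 R.l_null intro!: R.associator_eq_zero)
    have "inv \<zero> \<in> carrier R" using nuc by (intro R.inv_middle_nucleus)
    then have "inv \<zero> = \<zero>" by (rule all)
    obtain m where "m \<in> \<Gamma>" "m \<noteq> 0" using nontrivial by blast
    then have "inner_pair \<zero> m"
      using nuc \<open>inv \<zero> = \<zero>\<close> by (simp add: inner_pair_def R0 act_zero R.l_null)
    then show False using rhs \<open>m \<noteq> 0\<close> by blast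
  qed
  then show "nonassoc_simple S"
    by (intro simpleI) (use rhs in blast)+
qed

end

section \<open>Integer powers and Laurent rings\<close>

lemma int_funpow_0 [simp]: "int_funpow A \<sigma> 0 = id"
  by (simp add: int_funpow_def id_def)

lemma int_funpow_1 [simp]: "int_funpow A \<sigma> 1 = \<sigma>"
  by (simp add: int_funpow_def)

lemma funpow_closed: "\<lbrakk>\<And>x. x \<in> A \<Longrightarrow> f x \<in> A; x \<in> A\<rbrakk> \<Longrightarrow> (f ^^ k) x \<in> A"
  by (induction k) auto

lemma int_funpow_closed:
  assumes "bij_betw \<sigma> A A" "x \<in> A" shows "int_funpow A \<sigma> k x \<in> A"
  using assms bij_betwE[OF assms(1)] bij_betwE[OF bij_betw_inv_into[OF assms(1)]]
  by (auto simp: int_funpow_def intro!: funpow_closed)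

lemma int_funpow_succ:
  assumes \<sigma>: "bij_betw \<sigma> A A" and x: "x \<in> A"
  shows "int_funpow A \<sigma> (k + 1) x = \<sigma> (int_funpow A \<sigma> k x)"
proof (cases "0 \<le> k")
  case True
  then show ?thesis by (simp add: int_funpow_def nat_add_distrib)
next
  case False
  define j where "j = nat (- k - 1)"
  have k: "nat (- k) = Suc j" "nat (- (k + 1)) = j" "k + 1 = - int j"
    using False by (auto simp: j_def)
  have "(inv_into A \<sigma> ^^ j) x \<in> A"
    using bij_betwE[OF bij_betw_inv_into[OF \<sigma>]] x by (auto intro!: funpow_closed)
  \<comment> \<open>For \<open>j = 0\<close> the exponent \<open>k + 1\<close> is \<open>0\<close>
    and falls into the non-negative branch of \<open>int_funpow\<close>.\<close>
  then show ?thesis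
    using False \<sigma> k by (cases "j = 0") (simp_all add: int_funpow_def bij_betw_inv_into_right)
qed

lemma int_funpow_pred:
  assumes \<sigma>: "bij_betw \<sigma> A A" and x: "x \<in> A"
  shows "int_funpow A \<sigma> (k - 1) x = inv_into A \<sigma> (int_funpow A \<sigma> k x)"
  using int_funpow_succ[OF assms, of "k - 1"] int_funpow_closed[OF assms, of "k - 1"] \<sigma>
  by (simp add: bij_betw_inv_into_left)

lemma int_funpow_add:
  assumes \<sigma>: "bij_betw \<sigma> A A" and x: "x \<in> A"
  shows "int_funpow A \<sigma> (j + k) x = int_funpow A \<sigma> j (int_funpow A \<sigma> k x)"
proof (induction j rule: int_induct[where k = 0])
  case base
  then show ?case by simp
next
  case (step1 i)
  then show ?case
    using int_funpow_succ[OF \<sigma> x, of "i + k"] int_funpow_succ[OF \<sigma> int_funpow_closed[OF \<sigma> x], of i k]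
    by (simp add: algebra_simps)
next
  case (step2 i)
  then show ?case
    using int_funpow_pred[OF \<sigma> x, of "i + k"] int_funpow_pred[OF \<sigma> int_funpow_closed[OF \<sigma> x], of i k]
    by (simp add: algebra_simps)
qed

text \<open>A map that carries \<open>\<sigma>\<close> to \<open>\<tau>\<close> carries the inverse
  to the inverse, hence every integer power. Below, \<open>h\<close> is a coefficient map, a
  commuting map, or the constant map at a fixed point.\<close>

lemma int_funpow_intertwine:
  assumes \<sigma>: "bij_betw \<sigma> A A" and \<tau>: "bij_betw \<tau> B B"
    and h: "\<And>x. x \<in> A \<Longrightarrow> h x \<in> B" and comm: "\<And>x. x \<in> A \<Longrightarrow> h (\<sigma> x) = \<tau> (h x)"
    and x: "x \<in> A"
  shows "h (int_funpow A \<sigma> k x) = int_funpow B \<tau> k (h x)"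
proof (induction k rule: int_induct[where k = 0])
  case base
  then show ?case by simp
next
  case (step1 i)
  then show ?case
    using int_funpow_closed[OF \<sigma> x] by (simp add: int_funpow_succ \<sigma> \<tau> x h comm)
next
  case (step2 i)
  define y where "y = inv_into A \<sigma> (int_funpow A \<sigma> i x)"
  have y: "y \<in> A" "\<sigma> y = int_funpow A \<sigma> i x"
    using int_funpow_closed[OF \<sigma> x] \<sigma>
    by (auto simp: y_def bij_betw_inv_into_right bij_betwE[OF bij_betw_inv_into[OF \<sigma>]])
  have "inv_into B \<tau> (\<tau> (h y)) = h y"
    using y h \<tau> by (simp add: bij_betw_inv_into_left)
  then show ?case
    using step2 y comm[OF y(1)] by (simp add: int_funpow_pred \<sigma> \<tau> x h y_def)
qed

section \<open>Products of powers of several bijections\<close>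

lemma multi_funpow_cong:
  "(\<And>i. i \<in> {1..k} \<Longrightarrow> a i = b i) \<Longrightarrow> multi_funpow A \<sigma> a k = multi_funpow A \<sigma> b k"
  by (induction k) auto

lemma multi_funpow_id: "(\<And>i. i \<in> {1..k} \<Longrightarrow> a i = 0) \<Longrightarrow> multi_funpow A \<sigma> a k = id"
  by (induction k) auto

text \<open>Unit vectors recover the single bijections, so that statements about all multidegrees
  specialize to them.\<close>

lemma multi_funpow_unit:
  "i \<in> {1..k} \<Longrightarrow> multi_funpow A \<sigma> (\<lambda>j. if j = i then 1 else 0) k = \<sigma> i"
proof (induction k)
  case (Suc k)
  show ?case
  proof (cases "i = Suc k")
    case True
    then have "multi_funpow A \<sigma> (\<lambda>j. if j = i then 1 else 0) k = id"
      by (intro multi_funpow_id) auto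
    then show ?thesis using True by simp
  next
    case False
    then show ?thesis using Suc by simp
  qed
qed simp

text \<open>Each factor commutes with \<open>h\<close> by \<open>int_funpow_intertwine\<close>. The
  map \<open>h\<close> need not be bijective: below it is also a constant map and right
  multiplication by \<open>u\<close>.\<close>

lemma multi_funpow_commute:
  assumes "\<And>i. i \<in> {1..k} \<Longrightarrow> bij_betw (\<sigma> i) A A"
    and "\<And>x. x \<in> A \<Longrightarrow> h x \<in> A"
    and "\<And>i x. \<lbrakk>i \<in> {1..k}; x \<in> A\<rbrakk> \<Longrightarrow> h (\<sigma> i x) = \<sigma> i (h x)"
    and "x \<in> A"
  shows "h (multi_funpow A \<sigma> a k x) = multi_funpow A \<sigma> a k (h x)"
  using assms
proof (induction k arbitrary: x)
  case (Suc k)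
  have \<sigma>: "bij_betw (\<sigma> (Suc k)) A A" using Suc.prems(1) by simp
  have "h (multi_funpow A \<sigma> a k (int_funpow A (\<sigma> (Suc k)) (a (Suc k)) x))
      = multi_funpow A \<sigma> a k (h (int_funpow A (\<sigma> (Suc k)) (a (Suc k)) x))"
    using Suc.prems by (intro Suc.IH int_funpow_closed[OF \<sigma>]) auto
  also have "h (int_funpow A (\<sigma> (Suc k)) (a (Suc k)) x) = int_funpow A (\<sigma> (Suc k)) (a (Suc k)) (h x)"
    using Suc.prems by (intro int_funpow_intertwine[OF \<sigma> \<sigma>]) auto
  finally show ?case by simp
qed simp

lemma multi_funpow_add:
  assumes "\<And>i. i \<in> {1..k} \<Longrightarrow> bij_betw (\<sigma> i) A A"
    and "\<And>i j x. \<lbrakk>i \<in> {1..k}; j \<in> {1..k}; x \<in> A\<rbrakk> \<Longrightarrow> \<sigma> i (\<sigma> j x) = \<sigma> j (\<sigma> i x)"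
    and "x \<in> A"
  shows "multi_funpow A \<sigma> (a + b) k x = multi_funpow A \<sigma> a k (multi_funpow A \<sigma> b k x)"
  using assms
proof (induction k arbitrary: x)
  case (Suc k)
  have \<sigma>: "bij_betw (\<sigma> (Suc k)) A A" using Suc.prems(1) by simp
  let ?p = "\<lambda>a. int_funpow A (\<sigma> (Suc k)) (a (Suc k))"
  have p: "?p a y \<in> A" if "y \<in> A" for a y
    using that \<sigma> by (rule int_funpow_closed[rotated])
  have "multi_funpow A \<sigma> (a + b) (Suc k) x = multi_funpow A \<sigma> (a + b) k (?p a (?p b x))"
    using Suc.prems(3) by (simp add: int_funpow_add[OF \<sigma>])
  also have "\<dots> = multi_funpow A \<sigma> a k (multi_funpow A \<sigma> b k (?p a (?p b x)))"
    using Suc.prems p by (intro Suc.IH) auto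
  \<comment> \<open>Commutativity moves the last power belonging to \<open>a\<close> outwards past
    the first \<open>k\<close> powers belonging to \<open>b\<close>.\<close>
  also have "multi_funpow A \<sigma> b k (?p a (?p b x)) = ?p a (multi_funpow A \<sigma> b k (?p b x))"
  proof (rule multi_funpow_commute[symmetric])
    show "?p a (\<sigma> i y) = \<sigma> i (?p a y)" if "i \<in> {1..k}" "y \<in> A" for i y
      using Suc.prems(2) bij_betwE[OF Suc.prems(1)[of i]] that
      by (intro int_funpow_intertwine[OF \<sigma> \<sigma>, symmetric]) auto
  qed (use Suc.prems p in auto)
  finally show ?case by simp
qed simp

lemma multi_funpow_image:
  assumes "\<And>i. i \<in> {1..k} \<Longrightarrow> bij_betw (\<sigma> i) A A" "\<And>i. i \<in> {1..k} \<Longrightarrow> \<sigma> i ` J = J" "J \<subseteq> A"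
  shows "multi_funpow A \<sigma> a k ` J = J"
  using assms
proof (induction k)
  case (Suc k)
  have \<sigma>: "inj_on (\<sigma> (Suc k)) A" "\<sigma> (Suc k) ` J = J"
    using Suc.prems(1)[of "Suc k"] Suc.prems(2)[of "Suc k"] by (auto simp: bij_betw_def)
  \<comment> \<open>This covers negative exponents.\<close>
  then have inv: "inv_into A (\<sigma> (Suc k)) ` J = J"
    using Suc.prems(3) inv_into_image_cancel[of "\<sigma> (Suc k)" A J] by simp
  have pow: "(f ^^ j) ` J = J" if "f ` J = J" for f :: "'a \<Rightarrow> 'a" and j
  proof (induction j)
    case (Suc j)
    have "(f ^^ Suc j) ` J = f ` ((f ^^ j) ` J)" by (simp add: image_comp comp_def)
    then show ?case using Suc that by simp
  qed simp
  have "int_funpow A (\<sigma> (Suc k)) (a (Suc k)) ` J = J"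
    using pow[OF \<sigma>(2)] pow[OF inv] by (simp add: int_funpow_def)
  moreover have "multi_funpow A \<sigma> a k ` J = J" using Suc by simp
  ultimately show ?case by (simp only: multi_funpow.simps image_comp[symmetric])
qed simp

text \<open>At a fixed point \<open>x\<close> the constant map with value \<open>x\<close> commutes
  with every \<open>\<sigma> i\<close>.\<close>

lemma multi_funpow_fixed:
  assumes "\<And>i. i \<in> {1..k} \<Longrightarrow> bij_betw (\<sigma> i) A A" "\<And>i. i \<in> {1..k} \<Longrightarrow> \<sigma> i x = x" "x \<in> A"
  shows "multi_funpow A \<sigma> a k x = x"
  using multi_funpow_commute[of k \<sigma> A "\<lambda>_. x" x a] assms by simp

lemma (in nonassoc_ring) multi_funpow_additive:
  assumes "\<And>i. i \<in> {1..k} \<Longrightarrow> additive_bijection R (\<sigma> i)"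
  shows "additive_bijection R (multi_funpow (carrier R) \<sigma> a k)"
  using assms
proof (induction k)
  case 0
  then show ?case by (simp add: additive_bijection_def bij_betw_def)
next
  case (Suc k)
  let ?p = "int_funpow (carrier R) (\<sigma> (Suc k)) (a (Suc k))"
  have p: "additive_bijection R ?p" using Suc.prems by (intro int_funpow_additive) simp
  have m: "additive_bijection R (multi_funpow (carrier R) \<sigma> a k)" using Suc by simp
  have "?p r \<in> carrier R" if "r \<in> carrier R" for r
    using p that by (auto simp: additive_bijection_def bij_betwE)
  moreover have "bij_betw (multi_funpow (carrier R) \<sigma> a (Suc k)) (carrier R) (carrier R)"
    using p m by (auto simp: additive_bijection_def simp del: comp_apply intro: bij_betw_trans)
  ultimately show ?case
    using p m by (simp add: additive_bijection_def comp_def)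
qed

section \<open>Generalized Laurent polynomials in one variable\<close>

context nonassoc_ring
begin

lemma laurent_ring_simps:
  "carrier (laurent_ring R \<tau>) = {f. (\<forall>i. f i \<in> carrier R) \<and> finite {i. f i \<noteq> \<zero>}}"
  "\<one>\<^bsub>laurent_ring R \<tau>\<^esub> = (\<lambda>i. if i = 0 then \<one> else \<zero>)"
  "\<zero>\<^bsub>laurent_ring R \<tau>\<^esub> = (\<lambda>_. \<zero>)"
  "f \<oplus>\<^bsub>laurent_ring R \<tau>\<^esub> g = (\<lambda>i. f i \<oplus> g i)"
  by (simp_all add: laurent_ring_def)

lemma additive_bijectionD:
  assumes "additive_bijection R \<tau>"
  shows "r \<in> carrier R \<Longrightarrow> \<tau> r \<in> carrier R"
    and "\<lbrakk>r \<in> carrier R; s \<in> carrier R\<rbrakk> \<Longrightarrow> \<tau> (r \<oplus> s) = \<tau> r \<oplus> \<tau> s"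
    and "\<tau> \<zero> = \<zero>"
    and "bij_betw \<tau> (carrier R) (carrier R)"
  using assms additive_bijection_zero[OF assms] by (auto simp: additive_bijection_def bij_betwE)

text \<open>The defining sum runs over the exact support of \<open>f\<close>; any finite superset
  may be used, as the extra terms vanish. Products with different left factors can thus be summed
  over a common index set.\<close>

lemma laurent_mult_eq:
  assumes \<tau>: "additive_bijection R \<tau>"
    and f: "\<And>i. f i \<in> carrier R" and g: "\<And>i. g i \<in> carrier R"
    and B: "finite B" "{i. f i \<noteq> \<zero>} \<subseteq> B"
  shows "(f \<otimes>\<^bsub>laurent_ring R \<tau>\<^esub> g) k = (\<Oplus>i\<in>B. f i \<otimes> int_funpow (carrier R) \<tau> i (g (k - i)))"
proof -
  note p = additive_bijectionD[OF int_funpow_additive[OF \<tau>]]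
  have "(\<Oplus>i\<in>{i. f i \<noteq> \<zero>}. f i \<otimes> int_funpow (carrier R) \<tau> i (g (k - i)))
      = (\<Oplus>i\<in>B. f i \<otimes> int_funpow (carrier R) \<tau> i (g (k - i)))"
    using B f g by (intro add.finprod_mono_neutral_cong_left) (auto simp: l_null p)
  then show ?thesis by (simp add: laurent_ring_def)
qed

lemma laurent_mult_closed:
  assumes \<tau>: "additive_bijection R \<tau>"
    and f: "f \<in> carrier (laurent_ring R \<tau>)" and g: "g \<in> carrier (laurent_ring R \<tau>)"
  shows "f \<otimes>\<^bsub>laurent_ring R \<tau>\<^esub> g \<in> carrier (laurent_ring R \<tau>)"
proof -
  note p = additive_bijectionD[OF int_funpow_additive[OF \<tau>]]
  let ?F = "{i. f i \<noteq> \<zero>}" and ?G = "{i. g i \<noteq> \<zero>}"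
  have fin: "finite ?F" "finite ?G" and fg: "\<And>i. f i \<in> carrier R" "\<And>i. g i \<in> carrier R"
    using f g by (auto simp: laurent_ring_simps)
  have eq: "(f \<otimes>\<^bsub>laurent_ring R \<tau>\<^esub> g) k = (\<Oplus>i\<in>?F. f i \<otimes> int_funpow (carrier R) \<tau> i (g (k - i)))" for k
    using fin fg by (intro laurent_mult_eq[OF \<tau>]) auto
  \<comment> \<open>The support of a product lies in the set of sums of the two supports.\<close>
  have "(f \<otimes>\<^bsub>laurent_ring R \<tau>\<^esub> g) k = \<zero>" if k: "k \<notin> (\<lambda>(i, j). i + j) ` (?F \<times> ?G)" for k
  proof -
    have "g (k - i) = \<zero>" if i: "i \<in> ?F" for i
    proof (rule ccontr)
      assume "g (k - i) \<noteq> \<zero>"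
      then have "i + (k - i) \<in> (\<lambda>(i, j). i + j) ` (?F \<times> ?G)" using i by blast
      then show False using k by simp
    qed
    then show ?thesis
      unfolding eq using fg by (intro add.finprod_one_eqI) (auto simp: p r_null)
  qed
  then have "{k. (f \<otimes>\<^bsub>laurent_ring R \<tau>\<^esub> g) k \<noteq> \<zero>} \<subseteq> (\<lambda>(i, j). i + j) ` (?F \<times> ?G)" by blast
  then have "finite {k. (f \<otimes>\<^bsub>laurent_ring R \<tau>\<^esub> g) k \<noteq> \<zero>}"
    using fin finite_subset by blast
  moreover have "(f \<otimes>\<^bsub>laurent_ring R \<tau>\<^esub> g) k \<in> carrier R" for k
    unfolding eq using fg by (intro finsum_closed) (auto simp: p)
  ultimately show ?thesis by (simp add: laurent_ring_simps)
qed

lemma laurent_mult_left_monom: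
  assumes \<tau>: "additive_bijection R \<tau>" and r: "r \<in> carrier R" and g: "\<And>i. g i \<in> carrier R"
  shows "(laurent_monom R r m \<otimes>\<^bsub>laurent_ring R \<tau>\<^esub> g) k = r \<otimes> int_funpow (carrier R) \<tau> m (g (k - m))"
proof -
  note p = additive_bijectionD[OF int_funpow_additive[OF \<tau>]]
  have "(laurent_monom R r m \<otimes>\<^bsub>laurent_ring R \<tau>\<^esub> g) k
      = (\<Oplus>i\<in>{m}. laurent_monom R r m i \<otimes> int_funpow (carrier R) \<tau> i (g (k - i)))"
    using r g by (intro laurent_mult_eq[OF \<tau>]) (auto simp: laurent_monom_def)
  then show ?thesis using r g by (simp add: finsum_insert p) (simp add: laurent_monom_def p)
qed

lemma laurent_mult_right_monom:
  assumes \<tau>: "additive_bijection R \<tau>" and r: "r \<in> carrier R" and f: "f \<in> carrier (laurent_ring R \<tau>)"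
  shows "(f \<otimes>\<^bsub>laurent_ring R \<tau>\<^esub> laurent_monom R r m) k = f (k - m) \<otimes> int_funpow (carrier R) \<tau> (k - m) r"
proof -
  note p = additive_bijectionD[OF int_funpow_additive[OF \<tau>]]
  \<comment> \<open>Only \<open>i = k - m\<close> can contribute; it is inserted because
    \<open>f\<close> may vanish there.\<close>
  let ?B = "insert (k - m) {i. f i \<noteq> \<zero>}"
  have fin: "finite ?B" and fc: "\<And>i. f i \<in> carrier R"
    using f by (auto simp: laurent_ring_simps)
  have "(f \<otimes>\<^bsub>laurent_ring R \<tau>\<^esub> laurent_monom R r m) k
      = (\<Oplus>i\<in>?B. f i \<otimes> int_funpow (carrier R) \<tau> i (laurent_monom R r m (k - i)))"
    using fin fc r by (intro laurent_mult_eq[OF \<tau>]) (auto simp: laurent_monom_def)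
  also have "\<dots> = (\<Oplus>i\<in>{k - m}. f i \<otimes> int_funpow (carrier R) \<tau> i r)"
    using fin fc r
    by (intro add.finprod_mono_neutral_cong_right) (auto simp: laurent_monom_def p r_null)
  finally show ?thesis using r fc by (simp add: finsum_insert p)
qed

lemma nonassoc_ring_laurent:
  assumes \<tau>: "additive_bijection R \<tau>" and one: "\<tau> \<one> = \<one>"
  shows "nonassoc_ring (laurent_ring R \<tau>)"
proof -
  note p = additive_bijectionD[OF int_funpow_additive[OF \<tau>]]
  let ?P = "laurent_ring R \<tau>"
  have add_closed: "(\<lambda>i. f i \<oplus> g i) \<in> carrier ?P" if "f \<in> carrier ?P" "g \<in> carrier ?P" for f g
  proof -
    have "{i. f i \<oplus> g i \<noteq> \<zero>} \<subseteq> {i. f i \<noteq> \<zero>} \<union> {i. g i \<noteq> \<zero>}"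
      by (auto simp: l_zero)
    moreover have "finite ({i. f i \<noteq> \<zero>} \<union> {i. g i \<noteq> \<zero>})"
      using that by (simp add: laurent_ring_simps)
    ultimately have "finite {i. f i \<oplus> g i \<noteq> \<zero>}" by (rule finite_subset)
    then show ?thesis using that by (simp add: laurent_ring_simps)
  qed
  have "abelian_group ?P"
  proof (rule abelian_groupI)
    show "\<exists>y\<in>carrier ?P. y \<oplus>\<^bsub>?P\<^esub> f = \<zero>\<^bsub>?P\<^esub>" if f: "f \<in> carrier ?P" for f
    proof (rule bexI)
      have "{i. \<ominus> f i \<noteq> \<zero>} \<subseteq> {i. f i \<noteq> \<zero>}" by auto
      moreover have "finite {i. f i \<noteq> \<zero>}" using f by (simp add: laurent_ring_simps)
      ultimately have "finite {i. \<ominus> f i \<noteq> \<zero>}" by (rule finite_subset)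
      then show "(\<lambda>i. \<ominus> f i) \<in> carrier ?P" using f by (simp add: laurent_ring_simps)
      show "(\<lambda>i. \<ominus> f i) \<oplus>\<^bsub>?P\<^esub> f = \<zero>\<^bsub>?P\<^esub>" using f by (auto simp: laurent_ring_simps l_neg)
    qed
  next
    show "f \<oplus>\<^bsub>?P\<^esub> g \<in> carrier ?P" if "f \<in> carrier ?P" "g \<in> carrier ?P" for f g
      using add_closed[OF that] by (simp only: laurent_ring_simps(4))
  qed (auto simp: laurent_ring_simps a_ac)
  moreover have "nonassoc_ring_axioms ?P"
  proof
    show "f \<otimes>\<^bsub>?P\<^esub> g \<in> carrier ?P" if "f \<in> carrier ?P" "g \<in> carrier ?P" for f g
      using laurent_mult_closed[OF \<tau> that] .
    have "{i. (if i = (0::int) then \<one> else \<zero>) \<noteq> \<zero>} \<subseteq> {0}" by auto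
    then have "finite {i. (if i = (0::int) then \<one> else \<zero>) \<noteq> \<zero>}" by (rule finite_subset) simp
    then show "\<one>\<^bsub>?P\<^esub> \<in> carrier ?P" by (simp add: laurent_ring_simps)
    have one_monom: "\<one>\<^bsub>?P\<^esub> = laurent_monom R \<one> 0"
      by (simp add: laurent_ring_simps laurent_monom_def)
    show "\<one>\<^bsub>?P\<^esub> \<otimes>\<^bsub>?P\<^esub> f = f" if "f \<in> carrier ?P" for f
      using that unfolding one_monom
      by (auto simp: fun_eq_iff laurent_mult_left_monom[OF \<tau>] laurent_ring_simps)
    have fix_one: "int_funpow (carrier R) \<tau> k \<one> = \<one>" for k
      using int_funpow_intertwine[of \<tau> "carrier R" \<tau> "carrier R" "\<lambda>_. \<one>" \<one> k] additive_bijectionD[OF \<tau>] one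
      by simp
    show "f \<otimes>\<^bsub>?P\<^esub> \<one>\<^bsub>?P\<^esub> = f" if "f \<in> carrier ?P" for f
      using that unfolding one_monom
      by (auto simp: fun_eq_iff laurent_mult_right_monom[OF \<tau>] fix_one laurent_ring_simps(1))
  next
    fix f g h assume fgh: "f \<in> carrier ?P" "g \<in> carrier ?P" "h \<in> carrier ?P"
    \<comment> \<open>This set contains the supports of \<open>f\<close>, of \<open>g\<close> and of
      their sum.\<close>
    let ?B = "{i. f i \<noteq> \<zero>} \<union> {i. g i \<noteq> \<zero>}" and ?C = "{i. h i \<noteq> \<zero>}"
    have fin: "finite ?B" "finite ?C"
      and c: "\<And>i. f i \<in> carrier R" "\<And>i. g i \<in> carrier R" "\<And>i. h i \<in> carrier R"
      using fgh by (auto simp: laurent_ring_simps)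
    show "(f \<oplus>\<^bsub>?P\<^esub> g) \<otimes>\<^bsub>?P\<^esub> h = f \<otimes>\<^bsub>?P\<^esub> h \<oplus>\<^bsub>?P\<^esub> g \<otimes>\<^bsub>?P\<^esub> h"
    proof
      fix k
      let ?q = "\<lambda>i. int_funpow (carrier R) \<tau> i (h (k - i))"
      have q: "?q i \<in> carrier R" for i using c by (simp add: p)
      have "((\<lambda>i. f i \<oplus> g i) \<otimes>\<^bsub>?P\<^esub> h) k = (\<Oplus>i\<in>?B. (f i \<oplus> g i) \<otimes> ?q i)"
        using fin c by (intro laurent_mult_eq[OF \<tau>]) auto
      also have "\<dots> = (\<Oplus>i\<in>?B. f i \<otimes> ?q i \<oplus> g i \<otimes> ?q i)"
        using c q by (intro finsum_cong) (auto simp: l_distr)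
      also have "\<dots> = (\<Oplus>i\<in>?B. f i \<otimes> ?q i) \<oplus> (\<Oplus>i\<in>?B. g i \<otimes> ?q i)"
        using c q by (intro finsum_addf) auto
      also have "(\<Oplus>i\<in>?B. f i \<otimes> ?q i) = (f \<otimes>\<^bsub>?P\<^esub> h) k"
        using fin c by (intro laurent_mult_eq[OF \<tau>, symmetric]) auto
      also have "(\<Oplus>i\<in>?B. g i \<otimes> ?q i) = (g \<otimes>\<^bsub>?P\<^esub> h) k"
        using fin c by (intro laurent_mult_eq[OF \<tau>, symmetric]) auto
      finally show "((f \<oplus>\<^bsub>?P\<^esub> g) \<otimes>\<^bsub>?P\<^esub> h) k = (f \<otimes>\<^bsub>?P\<^esub> h \<oplus>\<^bsub>?P\<^esub> g \<otimes>\<^bsub>?P\<^esub> h) k"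
        by (simp add: laurent_ring_simps)
    qed
    show "h \<otimes>\<^bsub>?P\<^esub> (f \<oplus>\<^bsub>?P\<^esub> g) = h \<otimes>\<^bsub>?P\<^esub> f \<oplus>\<^bsub>?P\<^esub> h \<otimes>\<^bsub>?P\<^esub> g"
    proof
      fix k
      let ?q = "\<lambda>f i. int_funpow (carrier R) \<tau> i (f (k - i))"
      have q: "?q f i \<in> carrier R" "?q g i \<in> carrier R" for i using c by (simp_all add: p)
      have "(h \<otimes>\<^bsub>?P\<^esub> (\<lambda>i. f i \<oplus> g i)) k = (\<Oplus>i\<in>?C. h i \<otimes> ?q (\<lambda>i. f i \<oplus> g i) i)"
        using fin c by (intro laurent_mult_eq[OF \<tau>]) auto
      also have "\<dots> = (\<Oplus>i\<in>?C. h i \<otimes> ?q f i \<oplus> h i \<otimes> ?q g i)"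
        using c q by (intro finsum_cong) (auto simp: r_distr p)
      also have "\<dots> = (\<Oplus>i\<in>?C. h i \<otimes> ?q f i) \<oplus> (\<Oplus>i\<in>?C. h i \<otimes> ?q g i)"
        using c q by (intro finsum_addf) auto
      also have "(\<Oplus>i\<in>?C. h i \<otimes> ?q f i) = (h \<otimes>\<^bsub>?P\<^esub> f) k"
        using fin c by (intro laurent_mult_eq[OF \<tau>, symmetric]) auto
      also have "(\<Oplus>i\<in>?C. h i \<otimes> ?q g i) = (h \<otimes>\<^bsub>?P\<^esub> g) k"
        using fin c by (intro laurent_mult_eq[OF \<tau>, symmetric]) auto
      finally show "(h \<otimes>\<^bsub>?P\<^esub> (f \<oplus>\<^bsub>?P\<^esub> g)) k = (h \<otimes>\<^bsub>?P\<^esub> f \<oplus>\<^bsub>?P\<^esub> h \<otimes>\<^bsub>?P\<^esub> g) k"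
        by (simp add: laurent_ring_simps)
    qed
  qed
  ultimately show ?thesis by (rule nonassoc_ring.intro)
qed

lemma nonassoc_ring_image:
  assumes "inj_on f (carrier R)" shows "nonassoc_ring (image_ring f R)"
proof -
  let ?Q = "image_ring f R"
  have Q: "carrier ?Q = f ` carrier R" "\<one>\<^bsub>?Q\<^esub> = f \<one>" "\<zero>\<^bsub>?Q\<^esub> = f \<zero>"
    "\<And>x y. \<lbrakk>x \<in> carrier R; y \<in> carrier R\<rbrakk> \<Longrightarrow> f x \<otimes>\<^bsub>?Q\<^esub> f y = f (x \<otimes> y)"
    "\<And>x y. \<lbrakk>x \<in> carrier R; y \<in> carrier R\<rbrakk> \<Longrightarrow> f x \<oplus>\<^bsub>?Q\<^esub> f y = f (x \<oplus> y)"
    using assms by (simp_all add: image_ring_def image_group_def monoid.defs)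
  have "abelian_group ?Q"
  proof (rule abelian_groupI)
    show "\<exists>y\<in>carrier ?Q. y \<oplus>\<^bsub>?Q\<^esub> x = \<zero>\<^bsub>?Q\<^esub>" if x: "x \<in> carrier ?Q" for x
    proof -
      obtain r where "r \<in> carrier R" "x = f r" using x by (auto simp: Q)
      then show ?thesis by (intro bexI[of _ "f (\<ominus> r)"]) (simp_all add: Q l_neg)
    qed
  qed (auto simp: Q a_ac)
  then show ?thesis
    by (rule nonassoc_ring.intro) (unfold_locales, auto simp: Q l_distr r_distr)
qed

end

lemma image_ring_simps:
  "carrier (image_ring f R) = f ` carrier R" "\<one>\<^bsub>image_ring f R\<^esub> = f \<one>\<^bsub>R\<^esub>" "\<zero>\<^bsub>image_ring f R\<^esub> = f \<zero>\<^bsub>R\<^esub>"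
  by (simp_all add: image_ring_def image_group_def monoid.defs)

lemma image_ring_ops:
  assumes "inj_on f (carrier R)" "x \<in> carrier R" "y \<in> carrier R"
  shows "f x \<otimes>\<^bsub>image_ring f R\<^esub> f y = f (x \<otimes>\<^bsub>R\<^esub> y)" "f x \<oplus>\<^bsub>image_ring f R\<^esub> f y = f (x \<oplus>\<^bsub>R\<^esub> y)"
  using assms by (simp_all add: image_ring_def image_group_def monoid.defs)

section \<open>Coefficientwise extension of maps\<close>

context skew_laurent
begin

text \<open>Surjectivity comes from \<open>T'\<close>, which inverts \<open>T\<close> coefficient by
  coefficient; injectivity comes from that of \<open>\<tau>\<close>.\<close>

lemma lift_bijection:
  assumes \<tau>: "additive_bijection R \<tau>"
    and T: "\<And>f. f \<in> carrier S \<Longrightarrow> T f \<in> carrier S" "\<And>f a. f \<in> carrier S \<Longrightarrow> coeff (T f) a = \<tau> (coeff f a)"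
    and T': "\<And>f. f \<in> carrier S \<Longrightarrow> T' f \<in> carrier S"
      "\<And>f a. f \<in> carrier S \<Longrightarrow> coeff (T' f) a = inv_into (carrier R) \<tau> (coeff f a)"
  shows "additive_bijection S T"
proof -
  note \<tau>' = R.additive_bijectionD[OF \<tau>]
  have "T (T' f) = f" if f: "f \<in> carrier S" for f
    using f \<tau>'(4) by (intro coeff_inject) (auto simp: T T' coeff_closed bij_betw_inv_into_right)
  then have "carrier S \<subseteq> T ` carrier S" using T'(1) by force
  moreover have "inj_on T (carrier S)"
  proof (rule inj_onI)
    fix f g assume fg: "f \<in> carrier S" "g \<in> carrier S" "T f = T g"
    show "f = g"
    proof (rule coeff_inject)
      fix a
      have "\<tau> (coeff f a) = \<tau> (coeff g a)" using fg T(2) by metis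
      moreover have "inj_on \<tau> (carrier R)" using \<tau>'(4) by (simp add: bij_betw_def)
      ultimately show "coeff f a = coeff g a"
        using fg(1,2) by (simp add: inj_on_eq_iff coeff_closed)
    qed (use fg in auto)
  qed
  moreover have "T (f \<oplus>\<^bsub>S\<^esub> g) = T f \<oplus>\<^bsub>S\<^esub> T g" if "f \<in> carrier S" "g \<in> carrier S" for f g
    using that by (intro coeff_inject) (auto simp: T coeff_add coeff_closed \<tau>')
  ultimately show ?thesis using T(1) by (auto simp: additive_bijection_def bij_betw_def)
qed

lemma lift_one:
  assumes "\<tau> \<one> = \<one>" "\<tau> \<zero> = \<zero>"
    and "\<And>f. f \<in> carrier S \<Longrightarrow> T f \<in> carrier S" "\<And>f a. f \<in> carrier S \<Longrightarrow> coeff (T f) a = \<tau> (coeff f a)"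
  shows "T \<one>\<^bsub>S\<^esub> = \<one>\<^bsub>S\<^esub>"
  using assms by (intro coeff_inject) (auto simp: one_eq_mon mon_closed coeff_mon grade_zero)

text \<open>The coefficient at \<open>a\<close> is a map intertwining \<open>T\<close> with
  \<open>\<tau>\<close>.\<close>

lemma coeff_lift_funpow:
  assumes "additive_bijection R \<tau>" "additive_bijection S T"
    and "\<And>f. f \<in> carrier S \<Longrightarrow> coeff (T f) a = \<tau> (coeff f a)" and "f \<in> carrier S"
  shows "coeff (int_funpow (carrier S) T j f) a = int_funpow (carrier R) \<tau> j (coeff f a)"
  using assms by (intro int_funpow_intertwine) (auto simp: additive_bijection_def coeff_closed)

lemma lift_funpow_mon:
  assumes \<tau>: "additive_bijection R \<tau>" and T: "additive_bijection S T"
    and "\<And>f a. f \<in> carrier S \<Longrightarrow> coeff (T f) a = \<tau> (coeff f a)" and r: "r \<in> carrier R" and a: "a \<in> \<Gamma>"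
  shows "int_funpow (carrier S) T j (mon r a) = mon (int_funpow (carrier R) \<tau> j r) a"
proof -
  note p = R.additive_bijectionD[OF R.int_funpow_additive[OF \<tau>]] S.additive_bijectionD[OF S.int_funpow_additive[OF T]]
  show ?thesis
    using r a by (intro coeff_inject)
      (auto simp: p mon_closed coeff_mon coeff_lift_funpow[OF \<tau> T assms(3)])
qed

end

section \<open>The iterated ring as a graded ring\<close>

text \<open>
  A multidegree is a function that vanishes outside \<open>{1..k}\<close>. Passing from level \<open>Suc k\<close> to its
  coefficient ring resets the entry \<open>Suc k\<close> to keep this so.
\<close>

definition grades :: "nat \<Rightarrow> (nat \<Rightarrow> int) set" where
  "grades k = {a. \<forall>i. i \<notin> {1..k} \<longrightarrow> a i = 0}"

text \<open>The zero for \<open>a \<noteq> 0\<close> at level \<open>0\<close> makes coefficients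
  vanish outside \<open>grades\<close>. The other defaults concern towers of the wrong shape, which
  do not occur in the carriers.\<close>

primrec tower_coeff :: "('a, 'm) ring_scheme \<Rightarrow> nat \<Rightarrow> 'a tower \<Rightarrow> (nat \<Rightarrow> int) \<Rightarrow> 'a" where
  "tower_coeff R 0 t a = (case t of Base r \<Rightarrow> if a = 0 then r else \<zero>\<^bsub>R\<^esub> | Laurent f \<Rightarrow> \<zero>\<^bsub>R\<^esub>)"
| "tower_coeff R (Suc k) t a =
     (case t of Base r \<Rightarrow> \<zero>\<^bsub>R\<^esub> | Laurent f \<Rightarrow> tower_coeff R k (f (a (Suc k))) (a(Suc k := 0)))"

primrec tower_mon ::
    "('a, 'm) ring_scheme \<Rightarrow> (nat \<Rightarrow> 'a \<Rightarrow> 'a) \<Rightarrow> nat \<Rightarrow> 'a \<Rightarrow> (nat \<Rightarrow> int) \<Rightarrow> 'a tower" where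
  "tower_mon R \<sigma> 0 r a = Base r"
| "tower_mon R \<sigma> (Suc k) r a =
     Laurent (laurent_monom (iterated_laurent R \<sigma> k) (tower_mon R \<sigma> k r (a(Suc k := 0))) (a (Suc k)))"

lemma grades_Suc_iff: "a \<in> grades (Suc k) \<longleftrightarrow> a(Suc k := 0) \<in> grades k"
  by (auto simp: grades_def)

lemma inj_Base: "inj_on Base A" and inj_Laurent: "inj_on Laurent B"
  by (auto simp: inj_on_def)

lemma map_tower_zero: "\<tau> \<zero>\<^bsub>R\<^esub> = \<zero>\<^bsub>R\<^esub> \<Longrightarrow>
  map_tower \<tau> \<zero>\<^bsub>iterated_laurent R \<sigma> k\<^esub> = \<zero>\<^bsub>iterated_laurent R \<sigma> k\<^esub>"
  by (induction k) (auto simp: image_ring_simps laurent_ring_def)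

text \<open>A map that fixes zero cannot enlarge a support, so finiteness survives at every
  level.\<close>

lemma map_tower_closed:
  assumes "\<tau> \<zero>\<^bsub>R\<^esub> = \<zero>\<^bsub>R\<^esub>" "\<And>r. r \<in> carrier R \<Longrightarrow> \<tau> r \<in> carrier R"
    and "t \<in> carrier (iterated_laurent R \<sigma> k)"
  shows "map_tower \<tau> t \<in> carrier (iterated_laurent R \<sigma> k)"
  using assms(3)
proof (induction k arbitrary: t)
  case 0
  then show ?case using assms(2) by (auto simp: image_ring_simps)
next
  case (Suc k)
  let ?L = "iterated_laurent R \<sigma> k"
  obtain f where f: "t = Laurent f" "\<And>i. f i \<in> carrier ?L" "finite {i. f i \<noteq> \<zero>\<^bsub>?L\<^esub>}"
    using Suc.prems by (auto simp: image_ring_simps laurent_ring_def)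
  have "{i. map_tower \<tau> (f i) \<noteq> \<zero>\<^bsub>?L\<^esub>} \<subseteq> {i. f i \<noteq> \<zero>\<^bsub>?L\<^esub>}"
    using map_tower_zero[of \<tau> R \<sigma> k] assms(1) by auto
  then have "finite {i. map_tower \<tau> (f i) \<noteq> \<zero>\<^bsub>?L\<^esub>}" using f(3) by (rule finite_subset)
  then show ?case using f Suc.IH by (auto simp: image_ring_simps laurent_ring_def)
qed

lemma tower_coeff_map:
  assumes "\<tau> \<zero>\<^bsub>R\<^esub> = \<zero>\<^bsub>R\<^esub>" "t \<in> carrier (iterated_laurent R \<sigma> k)"
  shows "tower_coeff R k (map_tower \<tau> t) a = \<tau> (tower_coeff R k t a)"
  using assms(2)
proof (induction k arbitrary: t a)
  case 0
  then show ?case using assms(1) by (auto simp: image_ring_simps)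
next
  case (Suc k)
  then obtain f where f: "t = Laurent f" "\<And>i. f i \<in> carrier (iterated_laurent R \<sigma> k)"
    by (auto simp: image_ring_simps laurent_ring_def)
  have "tower_coeff R (Suc k) (map_tower \<tau> t) a
      = tower_coeff R k (map_tower \<tau> (f (a (Suc k)))) (a(Suc k := 0))"
    by (simp add: f(1))
  also have "\<dots> = \<tau> (tower_coeff R k (f (a (Suc k))) (a(Suc k := 0)))"
    by (rule Suc.IH[OF f(2)])
  finally show ?case by (simp add: f(1))
qed

section \<open>Induction on the number of variables\<close>

locale commuting_bijections = nonassoc_ring R for R (structure) +
  fixes n :: nat and \<sigma> :: "nat \<Rightarrow> 'a \<Rightarrow> 'a"
  assumes bijection: "\<And>i. i \<in> {1..n} \<Longrightarrow> additive_bijection R (\<sigma> i)"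
    and fix_one: "\<And>i. i \<in> {1..n} \<Longrightarrow> \<sigma> i \<one> = \<one>"
    and commute: "\<And>i j r. \<lbrakk>i \<in> {1..n}; j \<in> {1..n}; r \<in> carrier R\<rbrakk> \<Longrightarrow> \<sigma> i (\<sigma> j r) = \<sigma> j (\<sigma> i r)"
begin

lemma bij: "i \<in> {1..n} \<Longrightarrow> bij_betw (\<sigma> i) (carrier R) (carrier R)"
  using bijection by (simp add: additive_bijection_def)

lemma skew_laurent_base:
  "skew_laurent R (iterated_laurent R \<sigma> 0) (grades 0) (\<lambda>a. multi_funpow (carrier R) \<sigma> a 0)
     (tower_coeff R 0) (tower_mon R \<sigma> 0)"
proof -
  have "nonassoc_ring (iterated_laurent R \<sigma> 0)"
    by (simp add: nonassoc_ring_image inj_Base)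
  moreover have "grades 0 = {0}" by (auto simp: grades_def)
  moreover have "skew_laurent_axioms R (iterated_laurent R \<sigma> 0) {0} (\<lambda>a. multi_funpow (carrier R) \<sigma> a 0)
     (tower_coeff R 0) (tower_mon R \<sigma> 0)"
    by (rule skew_laurent_axioms.intro)
      (auto simp: image_ring_simps image_ring_ops inj_Base additive_bijection_def bij_betw_def)
  ultimately show ?thesis
    using nonassoc_ring_axioms by (simp add: skew_laurent_def)
qed

text \<open>A product with a monomial is computed first in the last variable, by the one-variable
  formulas, and then in the coefficient ring, by the induction hypothesis. The two twists compose to
  the action of the full multidegree.\<close>

lemma skew_laurent_step:
  assumes k: "Suc k \<le> n"
    and IH: "skew_laurent R (iterated_laurent R \<sigma> k) (grades k) (\<lambda>a. multi_funpow (carrier R) \<sigma> a k)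
      (tower_coeff R k) (tower_mon R \<sigma> k)"
  shows "skew_laurent R (iterated_laurent R \<sigma> (Suc k)) (grades (Suc k))
    (\<lambda>a. multi_funpow (carrier R) \<sigma> a (Suc k)) (tower_coeff R (Suc k)) (tower_mon R \<sigma> (Suc k))"
proof -
  let ?L = "iterated_laurent R \<sigma> k"
  let ?T = "map_tower (\<sigma> (Suc k))"
  let ?P = "laurent_ring ?L ?T"
  let ?Q = "iterated_laurent R \<sigma> (Suc k)"
  let ?p = "\<lambda>j. int_funpow (carrier R) (\<sigma> (Suc k)) j"
  let ?r = "\<lambda>a::nat \<Rightarrow> int. a(Suc k := 0)"
  interpret L: skew_laurent R ?L "grades k" "\<lambda>a. multi_funpow (carrier R) \<sigma> a k"
    "tower_coeff R k" "tower_mon R \<sigma> k"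
    by (rule IH)
  have \<tau>: "additive_bijection R (\<sigma> (Suc k))" using bijection k by simp
  have \<tau>0: "\<sigma> (Suc k) \<zero> = \<zero>" and \<tau>1: "\<sigma> (Suc k) \<one> = \<one>"
    and \<tau>_closed: "\<And>r. r \<in> carrier R \<Longrightarrow> \<sigma> (Suc k) r \<in> carrier R"
    using additive_bijectionD[OF \<tau>] fix_one k by auto
  let ?inv = "inv_into (carrier R) (\<sigma> (Suc k))"
  have bij': "bij_betw ?inv (carrier R) (carrier R)"
    by (intro bij_betw_inv_into bij) (use k in auto)
  \<comment> \<open>With this, \<open>map_tower ?inv\<close> preserves the carrier and can serve as
    the inverse of \<open>?T\<close>.\<close>
  have inv0: "?inv \<zero> = \<zero>"
    using bij_betw_inv_into_left[OF bij, of "Suc k" \<zero>] k \<tau>0 by simp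
  note T_closed = map_tower_closed[where \<tau> = "\<sigma> (Suc k)" and R = R and \<sigma> = \<sigma> and k = k, OF \<tau>0 \<tau>_closed]
    and T_coeff = tower_coeff_map[where \<tau> = "\<sigma> (Suc k)" and R = R and \<sigma> = \<sigma> and k = k, OF \<tau>0]
  have T: "additive_bijection ?L ?T"
    by (rule L.lift_bijection[OF \<tau>, of _ "map_tower ?inv"])
      (auto intro!: T_closed T_coeff map_tower_closed tower_coeff_map simp: inv0 bij_betwE[OF bij'])
  have T1: "?T \<one>\<^bsub>?L\<^esub> = \<one>\<^bsub>?L\<^esub>"
    by (rule L.lift_one[OF \<tau>1 \<tau>0]) (auto intro!: T_closed T_coeff)
  note p = L.S.additive_bijectionD[OF L.S.int_funpow_additive[OF T]]
    and q = additive_bijectionD[OF int_funpow_additive[OF \<tau>]]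
  note Tp_coeff = L.coeff_lift_funpow[OF \<tau> T T_coeff]
    and Tp_mon = L.lift_funpow_mon[OF \<tau> T T_coeff]
  interpret P: nonassoc_ring ?P by (rule L.S.nonassoc_ring_laurent[OF T T1])
  have Q: "nonassoc_ring ?Q" using P.nonassoc_ring_image[of Laurent] by (simp add: inj_Laurent)
  have carrier_Q: "t \<in> carrier ?Q \<longleftrightarrow> (\<exists>f\<in>carrier ?P. t = Laurent f)" for t
    by (auto simp: image_ring_simps)
  note iterated_laurent.simps [simp del]
  have carrier_P: "f \<in> carrier ?P \<longleftrightarrow> (\<forall>i. f i \<in> carrier ?L) \<and> finite {i. f i \<noteq> \<zero>\<^bsub>?L\<^esub>}" for f
    by (simp add: laurent_ring_def)
  have mult_Q: "Laurent f \<otimes>\<^bsub>?Q\<^esub> Laurent g = Laurent (f \<otimes>\<^bsub>?P\<^esub> g)"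
    and add_Q: "Laurent f \<oplus>\<^bsub>?Q\<^esub> Laurent g = Laurent (f \<oplus>\<^bsub>?P\<^esub> g)"
    if "f \<in> carrier ?P" "g \<in> carrier ?P" for f g
    using image_ring_ops[OF inj_Laurent that] by (simp_all add: iterated_laurent.simps)
  have monom_closed: "laurent_monom ?L t j \<in> carrier ?P" if "t \<in> carrier ?L" for t j
  proof -
    have "{i. laurent_monom ?L t j i \<noteq> \<zero>\<^bsub>?L\<^esub>} \<subseteq> {j}" by (auto simp: laurent_monom_def)
    then have "finite {i. laurent_monom ?L t j i \<noteq> \<zero>\<^bsub>?L\<^esub>}" by (rule finite_subset) simp
    then show ?thesis using that by (simp add: carrier_P laurent_monom_def)
  qed
  \<comment> \<open>The first \<open>k\<close> factors do not read entry
    \<open>Suc k\<close>.\<close>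
  have act_restrict: "multi_funpow (carrier R) \<sigma> (?r a) k = multi_funpow (carrier R) \<sigma> a k" for a
    by (intro multi_funpow_cong) auto
  have restrict_diff: "?r (b - a) = ?r b - ?r a" for a b
    by (auto simp: fun_eq_iff)
  have "skew_laurent_axioms R ?Q (grades (Suc k)) (\<lambda>a. multi_funpow (carrier R) \<sigma> a (Suc k))
    (tower_coeff R (Suc k)) (tower_mon R \<sigma> (Suc k))"
  proof (rule skew_laurent_axioms.intro)
    show "0 \<in> grades (Suc k)" by (simp add: grades_def)
    show "a + b \<in> grades (Suc k)" if "a \<in> grades (Suc k)" "b \<in> grades (Suc k)" for a b
      using that by (simp add: grades_def)
    show "- a \<in> grades (Suc k)" if "a \<in> grades (Suc k)" for a
      using that by (simp add: grades_def)
    show "additive_bijection R (multi_funpow (carrier R) \<sigma> a (Suc k))" for a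
      using k by (intro multi_funpow_additive bijection) simp
    show "multi_funpow (carrier R) \<sigma> (a + b) (Suc k) r
        = multi_funpow (carrier R) \<sigma> a (Suc k) (multi_funpow (carrier R) \<sigma> b (Suc k) r)"
      if "r \<in> carrier R" for a b r
      using k that by (intro multi_funpow_add bij commute) auto
    show "multi_funpow (carrier R) \<sigma> a (Suc k) \<one> = \<one>" for a
      using k by (intro multi_funpow_fixed bij fix_one) auto
  next
    fix t a assume t: "t \<in> carrier ?Q"
    then obtain f where f: "f \<in> carrier ?P" "t = Laurent f" by (auto simp: carrier_Q)
    then have fc: "\<And>i. f i \<in> carrier ?L" and fin: "finite {i. f i \<noteq> \<zero>\<^bsub>?L\<^esub>}" by (auto simp: carrier_P)
    show "tower_coeff R (Suc k) t a \<in> carrier R"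
      using f fc by (simp add: L.coeff_closed)
    show "tower_coeff R (Suc k) t a = \<zero>" if "a \<notin> grades (Suc k)"
      using f fc that by (simp add: grades_Suc_iff L.coeff_outside)
    \<comment> \<open>A degree in the support arises from one of the finitely many non-zero
      \<open>f i\<close> and a degree in its finite support, with entry \<open>Suc k\<close> set to
      \<open>i\<close>.\<close>
    let ?A = "\<Union>i\<in>{i. f i \<noteq> \<zero>\<^bsub>?L\<^esub>}. (\<lambda>a. a(Suc k := i)) ` {a. tower_coeff R k (f i) a \<noteq> \<zero>}"
    have "a \<in> ?A" if "tower_coeff R (Suc k) t a \<noteq> \<zero>" for a
    proof -
      have "tower_coeff R k (f (a (Suc k))) (?r a) \<noteq> \<zero>" using that f by simp
      moreover from this have "f (a (Suc k)) \<noteq> \<zero>\<^bsub>?L\<^esub>" using L.coeff_zero by auto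
      moreover have "a = (?r a)(Suc k := a (Suc k))" by simp
      ultimately show ?thesis by blast
    qed
    then have "{a. tower_coeff R (Suc k) t a \<noteq> \<zero>} \<subseteq> ?A" by blast
    moreover have "finite ?A" using fin fc L.finite_support by blast
    ultimately show "finite {a. tower_coeff R (Suc k) t a \<noteq> \<zero>}" by (rule finite_subset)
  next
    fix s t assume "s \<in> carrier ?Q" "t \<in> carrier ?Q"
    then obtain f g where fg: "f \<in> carrier ?P" "s = Laurent f" "g \<in> carrier ?P" "t = Laurent g"
      by (auto simp: carrier_Q)
    then have c: "\<And>i. f i \<in> carrier ?L" "\<And>i. g i \<in> carrier ?L" by (auto simp: carrier_P)
    show "tower_coeff R (Suc k) (s \<oplus>\<^bsub>?Q\<^esub> t) a = tower_coeff R (Suc k) s a \<oplus> tower_coeff R (Suc k) t a" for a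
      using fg c add_Q by (simp add: L.S.laurent_ring_simps L.coeff_add)
    show "s = t" if eq: "\<And>a. a \<in> grades (Suc k) \<Longrightarrow> tower_coeff R (Suc k) s a = tower_coeff R (Suc k) t a"
    proof -
      \<comment> \<open>The multidegrees whose entry \<open>Suc k\<close> is \<open>i\<close> see
        exactly the coefficients of \<open>f i\<close>.\<close>
      have "f i = g i" for i
      proof (rule L.coeff_inject[OF c])
        fix a assume a: "a \<in> grades k"
        then have "a (Suc k) = 0" by (simp add: grades_def)
        then have upd: "a(Suc k := 0) = a" by auto
        have "a(Suc k := i) \<in> grades (Suc k)" using a by (simp add: grades_Suc_iff upd)
        from eq[OF this] show "tower_coeff R k (f i) a = tower_coeff R k (g i) a"
          using fg by (simp add: upd)
      qed
      then show ?thesis using fg by auto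
    qed
  next
    fix r a assume r: "r \<in> carrier R" and "a \<in> grades (Suc k)"
    then have a: "?r a \<in> grades k" by (simp add: grades_Suc_iff)
    let ?m = "tower_mon R \<sigma> k r (?r a)"
    have m: "?m \<in> carrier ?L" using r a by (rule L.mon_closed)
    have M: "tower_mon R \<sigma> (Suc k) r a = Laurent (laurent_monom ?L ?m (a (Suc k)))" by simp
    show "tower_mon R \<sigma> (Suc k) r a \<in> carrier ?Q"
      unfolding M carrier_Q using monom_closed[OF m] by blast
    have eq_iff: "b = a \<longleftrightarrow> b (Suc k) = a (Suc k) \<and> ?r b = ?r a" for b
      by (metis fun_upd_triv fun_upd_upd)
    show "tower_coeff R (Suc k) (tower_mon R \<sigma> (Suc k) r a) b = (if b = a then r else \<zero>)" for b
      using r a by (subst eq_iff) (simp add: laurent_monom_def L.coeff_mon L.coeff_zero)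
    fix t b assume "t \<in> carrier ?Q" and "b \<in> grades (Suc k)"
    then obtain f where f: "f \<in> carrier ?P" "t = Laurent f" and b: "?r b \<in> grades k"
      by (auto simp: carrier_Q grades_Suc_iff)
    then have fc: "\<And>i. f i \<in> carrier ?L" by (auto simp: carrier_P)
    have ba: "(b - a) (Suc k) = b (Suc k) - a (Suc k)" by simp
    let ?x = "f (b (Suc k) - a (Suc k))"
    have coeff_t: "tower_coeff R (Suc k) t (b - a) = tower_coeff R k ?x (?r b - ?r a)"
      using f by (simp only: tower_coeff.simps tower.case restrict_diff ba)
    have "tower_coeff R (Suc k) (tower_mon R \<sigma> (Suc k) r a \<otimes>\<^bsub>?Q\<^esub> t) b
        = tower_coeff R k ((laurent_monom ?L ?m (a (Suc k)) \<otimes>\<^bsub>?P\<^esub> f) (b (Suc k))) (?r b)"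
      unfolding M f(2) mult_Q[OF monom_closed[OF m] f(1)] by simp
    \<comment> \<open>The last variable contributes the shift by \<open>a (Suc k)\<close> and a
      power of \<open>?T\<close>, which the next step turns into a power of
      \<open>\<sigma> (Suc k)\<close> on coefficients.\<close>
    also have "\<dots> = tower_coeff R k (?m \<otimes>\<^bsub>?L\<^esub> int_funpow (carrier ?L) ?T (a (Suc k)) ?x) (?r b)"
      by (simp only: L.S.laurent_mult_left_monom[OF T m fc])
    also have "\<dots> = r \<otimes> multi_funpow (carrier R) \<sigma> (?r a) k (?p (a (Suc k)) (tower_coeff R k ?x (?r b - ?r a)))"
      using r a b fc by (simp only: L.coeff_mon_mult p Tp_coeff)
    finally show "tower_coeff R (Suc k) (tower_mon R \<sigma> (Suc k) r a \<otimes>\<^bsub>?Q\<^esub> t) b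
        = r \<otimes> multi_funpow (carrier R) \<sigma> a (Suc k) (tower_coeff R (Suc k) t (b - a))"
      by (simp only: coeff_t act_restrict multi_funpow.simps comp_apply)
    have "tower_coeff R (Suc k) (t \<otimes>\<^bsub>?Q\<^esub> tower_mon R \<sigma> (Suc k) r a) b
        = tower_coeff R k ((f \<otimes>\<^bsub>?P\<^esub> laurent_monom ?L ?m (a (Suc k))) (b (Suc k))) (?r b)"
      unfolding M f(2) mult_Q[OF f(1) monom_closed[OF m]] by simp
    also have "\<dots> = tower_coeff R k (?x \<otimes>\<^bsub>?L\<^esub> int_funpow (carrier ?L) ?T (b (Suc k) - a (Suc k)) ?m) (?r b)"
      by (simp only: L.S.laurent_mult_right_monom[OF T m f(1)])
    \<comment> \<open>Powers of \<open>?T\<close> take monomials to monomials, so the right factor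
      stays a monomial of level \<open>k\<close>.\<close>
    also have "\<dots> = tower_coeff R k (?x \<otimes>\<^bsub>?L\<^esub> tower_mon R \<sigma> k (?p (b (Suc k) - a (Suc k)) r) (?r a)) (?r b)"
      by (simp only: Tp_mon[OF _ r a])
    also have "\<dots> = tower_coeff R k ?x (?r b - ?r a)
        \<otimes> multi_funpow (carrier R) \<sigma> (?r b - ?r a) k (?p (b (Suc k) - a (Suc k)) r)"
      using r a b fc by (intro L.coeff_mult_mon) (simp_all add: q)
    finally show "tower_coeff R (Suc k) (t \<otimes>\<^bsub>?Q\<^esub> tower_mon R \<sigma> (Suc k) r a) b
        = tower_coeff R (Suc k) t (b - a) \<otimes> multi_funpow (carrier R) \<sigma> (b - a) (Suc k) r"
      by (simp only: coeff_t restrict_diff[symmetric] act_restrict multi_funpow.simps comp_apply ba)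
  qed
  then show ?thesis
    using nonassoc_ring_axioms Q by (simp add: skew_laurent_def)
qed

lemma skew_laurent_iterated:
  "k \<le> n \<Longrightarrow> skew_laurent R (iterated_laurent R \<sigma> k) (grades k) (\<lambda>a. multi_funpow (carrier R) \<sigma> a k)
     (tower_coeff R k) (tower_mon R \<sigma> k)"
proof (induction k)
  case 0
  show ?case by (rule skew_laurent_base)
next
  case (Suc k)
  then show ?case by (intro skew_laurent_step) simp_all
qed

section \<open>From multidegrees back to the single bijections\<close>

lemma invariant_ideal_iff:
  assumes "J \<subseteq> carrier R"
  shows "(\<forall>a\<in>grades n. multi_funpow (carrier R) \<sigma> a n ` J = J) \<longleftrightarrow> (\<forall>i\<in>{1..n}. \<sigma> i ` J = J)"
proof
  assume *: "\<forall>a\<in>grades n. multi_funpow (carrier R) \<sigma> a n ` J = J"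
  show "\<forall>i\<in>{1..n}. \<sigma> i ` J = J"
  proof
    fix i assume i: "i \<in> {1..n}"
    then have "(\<lambda>j. if j = i then 1 else 0) \<in> grades n" by (auto simp: grades_def)
    then show "\<sigma> i ` J = J" using * multi_funpow_unit[OF i, of "carrier R" \<sigma>] by metis
  qed
next
  assume inv: "\<forall>i\<in>{1..n}. \<sigma> i ` J = J"
  show "\<forall>a\<in>grades n. multi_funpow (carrier R) \<sigma> a n ` J = J"
  proof
    show "multi_funpow (carrier R) \<sigma> a n ` J = J" for a
      by (rule multi_funpow_image[OF bij _ assms]) (use inv in blast)+
  qed
qed

text \<open>Unit vectors give one direction; for the other, right multiplication by \<open>u\<close>
  is the map \<open>h\<close> of \<open>multi_funpow_commute\<close>.\<close>

lemma commutes_with_right_mult_iff: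
  assumes u: "u \<in> carrier R"
  shows "(\<forall>r\<in>carrier R. \<forall>a\<in>grades n.
      multi_funpow (carrier R) \<sigma> a n (r \<otimes> u) = multi_funpow (carrier R) \<sigma> a n r \<otimes> u) \<longleftrightarrow>
    (\<forall>r\<in>carrier R. \<forall>i\<in>{1..n}. \<sigma> i (r \<otimes> u) = \<sigma> i r \<otimes> u)"
    (is "?lhs \<longleftrightarrow> ?rhs")
proof
  assume *: ?lhs
  show ?rhs
  proof (intro ballI)
    fix r i assume r: "r \<in> carrier R" and i: "i \<in> {1..n}"
    then have "(\<lambda>j. if j = i then 1 else 0) \<in> grades n" by (auto simp: grades_def)
    then show "\<sigma> i (r \<otimes> u) = \<sigma> i r \<otimes> u" using * r multi_funpow_unit[OF i, of "carrier R" \<sigma>] by metis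
  qed
next
  assume ?rhs
  then show ?lhs
    using u by (intro ballI multi_funpow_commute[where h = "\<lambda>r. r \<otimes> u", symmetric] bij) auto
qed

end

text \<open>At an index \<open>i\<close> with \<open>m i \<noteq> 0\<close> the \<open>k\<close>-th
  iterate has the entry \<open>k * m i\<close>, which determines \<open>k\<close>.\<close>

lemma inj_funpow_add:
  fixes m :: "nat \<Rightarrow> int"
  assumes "m \<noteq> 0" shows "inj (\<lambda>k. ((+) m ^^ k) 0)"
proof (rule injI)
  fix j k assume eq: "((+) m ^^ j) 0 = ((+) m ^^ k) 0"
  have pow: "((+) m ^^ k) 0 i = int k * m i" for k i
    by (induction k) (auto simp: algebra_simps)
  obtain i where "m i \<noteq> 0" using assms by (auto simp: fun_eq_iff)
  moreover have "int j * m i = int k * m i" using eq pow by metis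
  ultimately show "j = k" by simp
qed

theorem theorem6:
  fixes R :: "('a, 'm) ring_scheme" (structure)
    and n :: nat
    and \<sigma> :: "nat \<Rightarrow> 'a \<Rightarrow> 'a"
  assumes "nonassoc_ring R"
    and "1 \<le> n"
    and "\<And>i. i \<in> {1..n} \<Longrightarrow> additive_bijection R (\<sigma> i)"
    and "\<And>i. i \<in> {1..n} \<Longrightarrow> \<sigma> i \<one> = \<one>"
    and "\<And>i j r. \<lbrakk>i \<in> {1..n}; j \<in> {1..n}; r \<in> carrier R\<rbrakk>
           \<Longrightarrow> \<sigma> i (\<sigma> j r) = \<sigma> j (\<sigma> i r)"
  shows "nonassoc_simple (iterated_laurent R \<sigma> n) \<longleftrightarrow>
    sigma_simple n \<sigma> R \<and>
    \<not> (\<exists>u \<in> middle_nucleus R \<inter> right_nucleus R \<inter> nonassoc_units R.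
         \<exists>m :: nat \<Rightarrow> int. (\<exists>i\<in>{1..n}. m i \<noteq> 0) \<and>
           (\<forall>r\<in>carrier R. \<forall>i\<in>{1..n}.
              multi_funpow (carrier R) \<sigma> m n r = (inv u \<otimes> r) \<otimes> u \<and>
              \<sigma> i (r \<otimes> u) = \<sigma> i r \<otimes> u))"
    (is "_ \<longleftrightarrow> _ \<and> \<not> (\<exists>u\<in>?N. \<exists>m. ?nz m \<and> ?cond u m)")
proof -
  interpret commuting_bijections R n \<sigma>
    using assms by (simp add: commuting_bijections_def commuting_bijections_axioms_def)
  let ?act = "\<lambda>a. multi_funpow (carrier R) \<sigma> a n"
  interpret L: skew_laurent R "iterated_laurent R \<sigma> n" "grades n" ?act "tower_coeff R n" "tower_mon R \<sigma> n"
    by (rule skew_laurent_iterated) simp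
  \<comment> \<open>The first unit vector is a multidegree because \<open>1 \<le> n\<close>.\<close>
  have "(\<lambda>j. if j = 1 then 1 else 0) \<in> grades n" "(\<lambda>j. if j = 1 then 1 else 0) \<noteq> (0 :: nat \<Rightarrow> int)"
    using \<open>1 \<le> n\<close> by (auto simp: grades_def fun_eq_iff)
  then have nontrivial: "\<exists>m\<in>grades n. m \<noteq> 0" by blast
  have ideals: "(\<forall>J. nonassoc_ideal J R \<and> (\<forall>a\<in>grades n. ?act a ` J = J) \<longrightarrow> J = {\<zero>} \<or> J = carrier R)
      \<longleftrightarrow> sigma_simple n \<sigma> R"
  proof -
    have "J \<subseteq> carrier R" if "nonassoc_ideal J R" for J
      using that by (simp add: nonassoc_ideal_def additive_subgroup.a_subset)
    then show ?thesis
      using invariant_ideal_iff unfolding sigma_simple_def sigma_ideal_def by metis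
  qed
  have pair_iff: "L.inner_pair u m \<longleftrightarrow> m \<in> grades n \<and> u \<in> ?N \<and> ?cond u m" for u m
  proof (cases "u \<in> ?N")
    case True
    then have "u \<in> carrier R" by (simp add: middle_nucleus_def)
    note comm = commutes_with_right_mult_iff[OF this]
    \<comment> \<open>Condition (i) does not involve \<open>i\<close> but stands under the
      quantifier over \<open>i\<close>; it can be pulled out because the range is non-empty.\<close>
    have "{1..n} \<noteq> {}" using \<open>1 \<le> n\<close> by simp
    then have "?cond u m \<longleftrightarrow> (\<forall>r\<in>carrier R. ?act m r = (inv u \<otimes> r) \<otimes> u) \<and>
        (\<forall>r\<in>carrier R. \<forall>i\<in>{1..n}. \<sigma> i (r \<otimes> u) = \<sigma> i r \<otimes> u)"
      by blast
    then show ?thesis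
      using True unfolding L.inner_pair_def by (simp only: ball_conj_distrib comm) blast
  qed (auto simp: L.inner_pair_def)
  have "(\<exists>u m. m \<noteq> 0 \<and> L.inner_pair u m) \<longleftrightarrow> (\<exists>u\<in>?N. \<exists>m. ?nz m \<and> ?cond u m)"
  proof
    assume "\<exists>u m. m \<noteq> 0 \<and> L.inner_pair u m"
    then obtain u m where um: "m \<noteq> 0" "m \<in> grades n" "u \<in> ?N" "?cond u m"
      using pair_iff by blast
    obtain i where "m i \<noteq> 0" using um(1) by (auto simp: fun_eq_iff)
    moreover from this have "i \<in> {1..n}" using um(2) unfolding grades_def by blast
    ultimately have "?nz m" by blast
    then show "\<exists>u\<in>?N. \<exists>m. ?nz m \<and> ?cond u m" using um by blast
  next
    assume "\<exists>u\<in>?N. \<exists>m. ?nz m \<and> ?cond u m"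
    then obtain u m where um: "u \<in> ?N" "?nz m" "?cond u m" by blast
    \<comment> \<open>Entries of \<open>m\<close> outside \<open>{1..n}\<close> are arbitrary;
      setting them to zero gives an element of \<open>grades n\<close> with the same action.\<close>
    let ?m = "\<lambda>i. if i \<in> {1..n} then m i else 0"
    have "?act ?m = ?act m" by (intro multi_funpow_cong) auto
    then have "?cond u ?m" using um(3) by simp
    moreover have "?m \<in> grades n" "?m \<noteq> 0" using um(2) by (auto simp: grades_def fun_eq_iff)
    ultimately show "\<exists>u m. m \<noteq> 0 \<and> L.inner_pair u m" using um(1) pair_iff by blast
  qed
  then show ?thesis
    using L.simple_iff[OF inj_funpow_add nontrivial] ideals by blast
qed

end
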